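(* Let $K$ be an infinite field and let $K_n$ denote the complete graph on $n\ge 2$ vertices. Then $\ell(J_{K_n})=2n-3$.
   Context: The complete graph $K_n$ has vertex set $[n]=\{1,\ldots,n\}$ and edge set $\{\{i,j\}\mid 1\le i<j\le n\}$. The binomial edge ideal of a finite simple graph $G=([n],E)$ is $J_G=(x_iy_j-x_jy_i \mid \{i,j\}\in E)\subset S=K[x_1,\ldots,x_n,y_1,\ldots,y_n]$. For a homogeneous ideal $I$ in a polynomial ring $A$ over $K$ with homogeneous maximal ideal $\mathfrak m$ (generated by all the variables of $A$), the Rees algebra is $A[It]=\bigoplus_{k\ge 0} I^k t^k$, the special fiber ring is $F(I)=A[It]/\mathfrak m A[It]$, and the analytic spread is $\ell(I)=\dim F(I)$ (Krull dimension). *)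

theory Defs
  imports
    "HOL-Library.Poly_Mapping"
    "HOL-Library.Extended_Nat"
    "HOL-Algebra.Ideal_Product"
    "HOL-Algebra.QuotRing"
    "HOL-Algebra.UnivPoly"
begin

section \<open>Polynomial rings in a given set of variables\<close>

text \<open>
  A monomial is a finitely supported exponent function and a polynomial is a finitely supported
  function from monomials to coefficients; \<open>mpoly_ring V\<close> is the ring $K[v \mid v \in V]$, where
  the coefficient field $K$ is the type \<open>'k\<close>.
\<close>

type_synonym ('v, 'k) mpoly = "('v \<Rightarrow>\<^sub>0 nat) \<Rightarrow>\<^sub>0 'k"

definition mpoly_ring :: "'v set \<Rightarrow> ('v, 'k::field) mpoly ring" where
  "mpoly_ring V =
     \<lparr> carrier = {p. \<forall>m \<in> Poly_Mapping.keys p. Poly_Mapping.keys m \<subseteq> V},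
       monoid.mult = (*), one = 1, ring.zero = 0, add = (+) \<rparr>"

definition mvar :: "'v \<Rightarrow> ('v, 'k::field) mpoly" where
  "mvar v = Poly_Mapping.single (Poly_Mapping.single v 1) 1"

definition hom_max_ideal :: "'v set \<Rightarrow> ('v, 'k::field) mpoly set" where
  "hom_max_ideal V = Idl\<^bsub>mpoly_ring V\<^esub> (mvar ` V)"


section \<open>Krull dimension\<close>

text \<open>
  The supremum of the lengths $m$ of strict chains $P_0 \subset \dots \subset P_m$ of prime ideals.
  As a supremum in \<open>enat\<close>, it is \<open>0\<close> for the zero ring.
\<close>

definition krull_dim :: "('a, 'm) ring_scheme \<Rightarrow> enat" where
  "krull_dim R =
     Sup {enat m | m. \<exists>P :: nat \<Rightarrow> 'a set.
       (\<forall>i \<le> m. primeideal (P i) R) \<and> (\<forall>i < m. P i \<subset> P (Suc i))}"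


section \<open>Rees algebra, special fiber ring, analytic spread\<close>

primrec ideal_power :: "('a, 'm) ring_scheme \<Rightarrow> 'a set \<Rightarrow> nat \<Rightarrow> 'a set" where
  "ideal_power R I 0 = carrier R"
| "ideal_power R I (Suc k) = ideal_prod R (ideal_power R I k) I"

text \<open>
  $R[It] = \bigoplus_k I^k t^k$ as a subring of the univariate polynomial ring $R[t]$.
\<close>

definition rees_algebra :: "('a, 'm) ring_scheme \<Rightarrow> 'a set \<Rightarrow> ('a, nat \<Rightarrow> 'a) up_ring" where
  "rees_algebra R I =
     (UP R) \<lparr> carrier := {f \<in> carrier (UP R). \<forall>k. coeff (UP R) f k \<in> ideal_power R I k} \<rparr>"

text \<open>
  $R[It]/\mathfrak{m}R[It]$, where $\mathfrak{m} \subseteq R$ is embedded into $R[It]$ in degree 0.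
\<close>

definition special_fiber ::
    "('a, 'm) ring_scheme \<Rightarrow> 'a set \<Rightarrow> 'a set \<Rightarrow> (nat \<Rightarrow> 'a) set ring" where
  "special_fiber R M I =
     rees_algebra R I Quot (Idl\<^bsub>rees_algebra R I\<^esub> ((\<lambda>a. monom (UP R) a 0) ` M))"

definition analytic_spread :: "'v set \<Rightarrow> ('v, 'k::field) mpoly set \<Rightarrow> enat" where
  "analytic_spread V I = krull_dim (special_fiber (mpoly_ring V) (hom_max_ideal V) I)"


section \<open>Binomial edge ideals\<close>

datatype xyvar = XVar nat | YVar nat

definition xyvars :: "nat \<Rightarrow> xyvar set" where
  "xyvars n = XVar ` {1..n} \<union> YVar ` {1..n}"

text \<open>
  A graph on the vertex set \<open>{1..n}\<close> is given by its set \<open>E\<close> of two-element edges.  Each edge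
  contributes its binomial with both signs, one for each ordering of its endpoints.
\<close>

definition binomial_edge_ideal :: "nat \<Rightarrow> nat set set \<Rightarrow> (xyvar, 'k::field) mpoly set" where
  "binomial_edge_ideal n E =
     Idl\<^bsub>mpoly_ring (xyvars n)\<^esub>
       {mvar (XVar i) * mvar (YVar j) - mvar (XVar j) * mvar (YVar i) | i j. {i, j} \<in> E}"

definition complete_graph_edges :: "nat \<Rightarrow> nat set set" where
  "complete_graph_edges n = {{i, j} | i j. 1 \<le> i \<and> i < j \<and> j \<le> n}"

end

theory Submission
  imports Defs "HOL-Computational_Algebra.Polynomial"
begin

text \<open>
  The edge ideal \<open>J\<close> of the complete graph is generated by the maximal minors \<open>f\<^sub>i\<^sub>j\<close> of the generic
  \<open>2 \<times> n\<close> matrix.  These all have degree \<open>2\<close>, so the special fiber ring is the algebra generated by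
  them, the coordinate ring of the affine cone over the Grassmannian of planes in \<open>n\<close>-space.  That cone
  has dimension \<open>2 (n - 2) + 1\<close>.  Both bounds on lengths of prime chains have direct arguments.

  Primes of the special fiber ring are primes of the Rees algebra that contain the maximal ideal \<open>\<mm>\<close> in
  degree \<open>0\<close> (\<open>special_fiber_prime_chain_iff\<close>).

  Upper bound.  In a chain \<open>P\<^sub>0 \<subset> \<dots> \<subset> P\<^sub>m\<close> choose \<open>a\<^sub>i \<in> P\<^sub>i\<^sub>+\<^sub>1 - P\<^sub>i\<close>.  The \<open>a\<^sub>i\<close> are algebraically
  independent modulo \<open>P\<^sub>0\<close> (\<open>prime_chain_monomials_independent\<close>), and modulo \<open>P\<^sub>0\<close> each of them is a
  polynomial over the field in the \<open>T\<^sub>i\<^sub>j = f\<^sub>i\<^sub>j t\<close>.  By the Pluecker relation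
  \<open>T\<^sub>1\<^sub>2 T\<^sub>i\<^sub>j = T\<^sub>1\<^sub>i T\<^sub>2\<^sub>j - T\<^sub>1\<^sub>j T\<^sub>2\<^sub>i\<close>, multiplication by a power of \<open>T\<^sub>1\<^sub>2\<close> turns such a polynomial into one
  in the \<open>2 n - 3\<close> elements \<open>T\<^sub>1\<^sub>2\<close>, \<open>T\<^sub>1\<^sub>j\<close>, \<open>T\<^sub>2\<^sub>j\<close> with \<open>j \<ge> 3\<close>.  Comparing the number of monomials of bounded
  degree in the \<open>a\<^sub>i\<close> with the number of those in \<open>2 n - 3\<close> elements gives \<open>m \<le> 2 n - 3\<close>
  (\<open>prime_chain_length_le_growth\<close>).

  Lower bound.  Evaluating the minors at the matrix with columns \<open>(x\<^sub>1, 0), (0, 1), (x\<^sub>3, y\<^sub>3), \<dots>, (x\<^sub>n, y\<^sub>n)\<close>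
  is a homomorphism from the special fiber ring to a polynomial ring.  Setting its \<open>2 n - 3\<close> free entries
  to zero one after another gives an increasing sequence of kernels, all prime, and each step is strict because
  \<open>x\<^sub>1\<close>, \<open>x\<^sub>1 y\<^sub>j\<close> and \<open>- x\<^sub>j\<close> are values of minors (\<open>fiber_prime_strict\<close>).
\<close>

section \<open>Rings on subsets of a type\<close>

text \<open>
  Polynomials are elements of a type class ring, while ideals, quotients and Krull dimension are
  notions for ring records.  A record whose carrier is a subset of a type and whose operations
  are those of the type lets primality be stated with the records while all calculations are
  done with the type class arithmetic.
\<close>
definition subring_set :: "'a::comm_ring_1 set \<Rightarrow> bool" where
  "subring_set C \<longleftrightarrow> 1 \<in> C \<and> (\<forall>x\<in>C. \<forall>y\<in>C. x - y \<in> C \<and> x * y \<in> C)"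

definition concrete_ring :: "'a::comm_ring_1 set \<Rightarrow> 'a ring" where
  "concrete_ring C =
     \<lparr> carrier = C, monoid.mult = (*), one = 1, ring.zero = 0, add = (+) \<rparr>"

lemma concrete_ring_simps [simp]:
  "carrier (concrete_ring C) = C"
  "monoid.mult (concrete_ring C) = (*)"
  "monoid.one (concrete_ring C) = 1"
  "ring.zero (concrete_ring C) = 0"
  "ring.add (concrete_ring C) = (+)"
  by (simp_all add: concrete_ring_def)

context
  fixes C :: "'a::comm_ring_1 set"
  assumes C: "subring_set C"
begin

lemma subring_set_one: "1 \<in> C"
  and subring_set_diff: "x \<in> C \<Longrightarrow> y \<in> C \<Longrightarrow> x - y \<in> C"
  and subring_set_mult: "x \<in> C \<Longrightarrow> y \<in> C \<Longrightarrow> x * y \<in> C"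
  using C by (auto simp: subring_set_def)

lemma subring_set_zero: "0 \<in> C"
  using subring_set_diff[OF subring_set_one subring_set_one] by simp

lemma subring_set_uminus: "x \<in> C \<Longrightarrow> - x \<in> C"
  using subring_set_diff[OF subring_set_zero] by force

lemma subring_set_add: "x \<in> C \<Longrightarrow> y \<in> C \<Longrightarrow> x + y \<in> C"
  using subring_set_diff[OF _ subring_set_uminus] by force

lemma subring_set_sum: "(\<And>i. i \<in> A \<Longrightarrow> f i \<in> C) \<Longrightarrow> sum f A \<in> C"
  by (induction A rule: infinite_finite_induct) (auto intro: subring_set_zero subring_set_add)

lemma subring_set_power: "x \<in> C \<Longrightarrow> x ^ k \<in> C"
  by (induction k) (auto intro: subring_set_one subring_set_mult)

lemma cring_concrete_ring: "cring (concrete_ring C)"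
proof (rule cringI)
  show "abelian_group (concrete_ring C)"
  proof (rule abelian_groupI)
    fix x assume "x \<in> carrier (concrete_ring C)"
    then show "\<exists>y\<in>carrier (concrete_ring C). y \<oplus>\<^bsub>concrete_ring C\<^esub> x = \<zero>\<^bsub>concrete_ring C\<^esub>"
      by (intro bexI[of _ "- x"]) (auto intro: subring_set_uminus)
  qed (auto intro: subring_set_zero subring_set_add)
  show "comm_monoid (concrete_ring C)"
    by (rule comm_monoidI) (auto intro: subring_set_one subring_set_mult simp: mult_ac)
qed (auto simp: algebra_simps)

lemma ideal_concrete_ringD:
  assumes "ideal I (concrete_ring C)"
  shows "I \<subseteq> C" "0 \<in> I" "x \<in> I \<Longrightarrow> y \<in> I \<Longrightarrow> x + y \<in> I"
    "x \<in> I \<Longrightarrow> c \<in> C \<Longrightarrow> c * x \<in> I" "x \<in> I \<Longrightarrow> - x \<in> I" "x \<in> I \<Longrightarrow> y \<in> I \<Longrightarrow> x - y \<in> I"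
proof -
  interpret ideal I "concrete_ring C" by fact
  show 1: "I \<subseteq> C" using Icarr by auto
  show "0 \<in> I" using additive_subgroup.zero_closed[OF is_additive_subgroup] by simp
  show add: "x + y \<in> I" if "x \<in> I" "y \<in> I" for x y using additive_subgroup.a_closed[OF is_additive_subgroup that] by simp
  show mult: "c * x \<in> I" if "x \<in> I" "c \<in> C" for x c using I_l_closed[of x c] that by simp
  show m: "- x \<in> I" if "x \<in> I" for x
    using mult[OF that subring_set_uminus[OF subring_set_one]] by simp
  show "x - y \<in> I" if "x \<in> I" "y \<in> I" for x y using add[OF that(1) m[OF that(2)]] by simp
qed

lemma ideal_concrete_ringI:
  assumes "I \<subseteq> C" "0 \<in> I" "\<And>x y. x \<in> I \<Longrightarrow> y \<in> I \<Longrightarrow> x + y \<in> I"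
    "\<And>x c. x \<in> I \<Longrightarrow> c \<in> C \<Longrightarrow> c * x \<in> I"
  shows "ideal I (concrete_ring C)"
proof -
  interpret cring "concrete_ring C" by (rule cring_concrete_ring)
  have minus: "- x \<in> I" if "x \<in> I" for x
    using assms(4)[OF that subring_set_uminus[OF subring_set_one]] by simp
  have inv: "\<ominus>\<^bsub>concrete_ring C\<^esub> x = - x" if "x \<in> C" for x
    using that by (intro minus_equality) (auto intro: subring_set_uminus)
  show ?thesis
  proof (rule idealI)
    show "subgroup I (add_monoid (concrete_ring C))"
      using assms(1-3) minus inv
      by (intro add.subgroupI) (auto simp: a_inv_def)
  qed (use assms in \<open>auto simp: mult.commute ring_axioms\<close>)
qed

lemma primeideal_concrete_ringD:
  assumes "primeideal P (concrete_ring C)"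
  shows "ideal P (concrete_ring C)" "1 \<notin> P"
    "x \<in> C \<Longrightarrow> y \<in> C \<Longrightarrow> x * y \<in> P \<Longrightarrow> x \<in> P \<or> y \<in> P"
proof -
  interpret primeideal P "concrete_ring C" by fact
  show "ideal P (concrete_ring C)" ..
  show "1 \<notin> P"
    using I_notcarr one_imp_carrier by auto
  show "x \<in> C \<Longrightarrow> y \<in> C \<Longrightarrow> x * y \<in> P \<Longrightarrow> x \<in> P \<or> y \<in> P"
    using I_prime[of x y] by simp
qed

text \<open>
  The source of all the primes in the lower bound: a kernel of a homomorphism to a domain, where
  the homomorphism may fail to be multiplicative outside the subring.
\<close>
lemma primeideal_kernel:
  fixes \<phi> :: "'a \<Rightarrow> 'b::idom"
  assumes "\<phi> 1 = 1" "\<And>x y. x \<in> C \<Longrightarrow> y \<in> C \<Longrightarrow> \<phi> (x + y) = \<phi> x + \<phi> y"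
    "\<And>x y. x \<in> C \<Longrightarrow> y \<in> C \<Longrightarrow> \<phi> (x * y) = \<phi> x * \<phi> y"
  shows "primeideal {x \<in> C. \<phi> x = 0} (concrete_ring C)"
proof (rule primeidealI)
  have "\<phi> 0 = 0" using assms(2)[OF subring_set_zero subring_set_zero] 
    by (metis add.right_neutral add_left_cancel)
  then show "ideal {x \<in> C. \<phi> x = 0} (concrete_ring C)"
    using assms by (intro ideal_concrete_ringI)
      (auto intro: subring_set_zero subring_set_add subring_set_mult)
  show "cring (concrete_ring C)" by (rule cring_concrete_ring)
  show "carrier (concrete_ring C) \<noteq> {x \<in> C. \<phi> x = 0}"
    using assms(1) subring_set_one by (metis (mono_tags, lifting) concrete_ring_simps(1) mem_Collect_eq zero_neq_one)
qed (use assms in \<open>auto\<close>)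

lemma finsum_concrete_ring:
  "(\<And>i. i \<in> A \<Longrightarrow> f i \<in> C) \<Longrightarrow> finsum (concrete_ring C) f A = sum f A"
proof (induction A rule: infinite_finite_induct)
  interpret cring "concrete_ring C" by (rule cring_concrete_ring)
  case (insert x F)
  then show ?case by (subst finsum_insert) auto
next
  interpret cring "concrete_ring C" by (rule cring_concrete_ring)
  case empty then show ?case by simp
next
  case (infinite A) then show ?case by (simp add: finsum_def finprod_def)
qed

end

section \<open>Chains of prime ideals\<close>

definition prime_chain :: "('a, 'm) ring_scheme \<Rightarrow> nat \<Rightarrow> (nat \<Rightarrow> 'a set) \<Rightarrow> bool" where
  "prime_chain R m P \<longleftrightarrow> (\<forall>i\<le>m. primeideal (P i) R) \<and> (\<forall>i<m. P i \<subset> P (Suc i))"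

lemma krull_dim_eq_enatI:
  assumes "\<exists>P. prime_chain R d P" and "\<And>m P. prime_chain R m P \<Longrightarrow> m \<le> d"
  shows "krull_dim R = enat d"
  unfolding krull_dim_def prime_chain_def[symmetric]
  by (rule antisym[OF Sup_least Sup_upper]) (use assms in auto)

lemma ideal_image_surj:
  assumes h: "ring_hom_ring R S h" and surj: "h ` carrier R = carrier S" and P: "ideal P R"
  shows "ideal (h ` P) S"
proof -
  interpret h: ring_hom_ring R S h by fact
  interpret P: ideal P R by fact
  show ?thesis
  proof (rule idealI)
    show "ring S" ..
    show "subgroup (h ` P) (add_monoid S)"
      by (rule h.img_is_add_subgroup) (rule P.a_subgroup)
    fix q s assume "q \<in> h ` P" "s \<in> carrier S"
    then obtain p r where p: "p \<in> P" "q = h p" and r: "r \<in> carrier R" "s = h r"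
      unfolding surj[symmetric] by blast
    have "p \<in> carrier R" using p P.Icarr by blast
    with p r have "s \<otimes>\<^bsub>S\<^esub> q = h (r \<otimes>\<^bsub>R\<^esub> p)" "q \<otimes>\<^bsub>S\<^esub> s = h (p \<otimes>\<^bsub>R\<^esub> r)" by simp_all
    then show "s \<otimes>\<^bsub>S\<^esub> q \<in> h ` P" "q \<otimes>\<^bsub>S\<^esub> s \<in> h ` P"
      using P.I_l_closed[OF p(1) r(1)] P.I_r_closed[OF p(1) r(1)] by auto
  qed
qed

text \<open>
  Primes that contain the kernel of a surjection are saturated, that is, unions of fibres; this is
  the second claim, and it lets primality and strict inclusions be carried forward.
\<close>
lemma primeideal_image_surj:
  assumes h: "ring_hom_ring R S h" and R: "cring R" and S: "cring S"
    and surj: "h ` carrier R = carrier S"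
    and P: "primeideal P R" and ker: "a_kernel R S h \<subseteq> P"
  shows "primeideal (h ` P) S" and "{x \<in> carrier R. h x \<in> h ` P} = P"
proof -
  interpret h: ring_hom_ring R S h by fact
  interpret P: primeideal P R by fact
  show vim: "{x \<in> carrier R. h x \<in> h ` P} = P"
  proof (safe)
    fix x p assume x: "x \<in> carrier R" and p: "p \<in> P" and eq: "h x = h p"
    have pc: "p \<in> carrier R" using p P.Icarr by blast
    have npc: "\<ominus>\<^bsub>R\<^esub> p \<in> carrier R" using pc by (rule h.R.a_inv_closed)
    have "h (x \<oplus>\<^bsub>R\<^esub> \<ominus>\<^bsub>R\<^esub> p) = h x \<oplus>\<^bsub>S\<^esub> \<ominus>\<^bsub>S\<^esub> h p"
      using x pc npc by simp
    also have "\<dots> = \<zero>\<^bsub>S\<^esub>" unfolding eq using pc by (intro h.S.r_neg) simp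
    finally have "x \<oplus>\<^bsub>R\<^esub> \<ominus>\<^bsub>R\<^esub> p \<in> P"
      using ker h.R.a_closed[OF x npc] unfolding a_kernel_def' by blast
    then have "x \<oplus>\<^bsub>R\<^esub> \<ominus>\<^bsub>R\<^esub> p \<oplus>\<^bsub>R\<^esub> p \<in> P"
      using additive_subgroup.a_closed[OF P.is_additive_subgroup] p by blast
    also have "x \<oplus>\<^bsub>R\<^esub> \<ominus>\<^bsub>R\<^esub> p \<oplus>\<^bsub>R\<^esub> p = x"
      using x pc npc by (simp add: h.R.a_assoc h.R.l_neg)
    finally show "x \<in> P" .
  qed (use P.Icarr in auto)
  have "ideal (h ` P) S" by (rule ideal_image_surj[OF h surj P.is_ideal])
  show "primeideal (h ` P) S"
  proof (rule primeidealI)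
    show "ideal (h ` P) S" by fact
    show "cring S" by fact
    show "carrier S \<noteq> h ` P"
    proof
      assume "carrier S = h ` P"
      then have "carrier R \<subseteq> P" using vim h.hom_closed by blast
      then show False using P.I_notcarr P.a_subset by blast
    qed
    fix a b assume "a \<in> carrier S" "b \<in> carrier S" and ab: "a \<otimes>\<^bsub>S\<^esub> b \<in> h ` P"
    then obtain x y where x: "x \<in> carrier R" "a = h x" and y: "y \<in> carrier R" "b = h y"
      unfolding surj[symmetric] by blast
    then have "x \<otimes>\<^bsub>R\<^esub> y \<in> P" using ab vim by force
    then show "a \<in> h ` P \<or> b \<in> h ` P" using P.I_prime x y by blast
  qed
qed

text \<open>
  The correspondence theorem for chains of primes: it turns chains in a quotient into chains in
  the original ring, where the elements are polynomials and not cosets.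
\<close>
lemma prime_chain_surj_iff:
  assumes h: "ring_hom_ring R S h" and R: "cring R" and S: "cring S"
    and surj: "h ` carrier R = carrier S"
  shows "(\<exists>Q. prime_chain S m Q) \<longleftrightarrow>
         (\<exists>P. prime_chain R m P \<and> (\<forall>i\<le>m. a_kernel R S h \<subseteq> P i))"
proof
  interpret h: ring_hom_ring R S h by fact
  assume "\<exists>Q. prime_chain S m Q"
  then obtain Q where Q: "\<And>i. i \<le> m \<Longrightarrow> primeideal (Q i) S" "\<And>i. i < m \<Longrightarrow> Q i \<subset> Q (Suc i)"
    by (auto simp: prime_chain_def)
  let ?P = "\<lambda>i. {x \<in> carrier R. h x \<in> Q i}"
  have "primeideal (?P i) R" if "i \<le> m" for i
    using h.primeideal_vimage[OF R Q(1)[OF that]] .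
  moreover have "?P i \<subset> ?P (Suc i)" if "i < m" for i
  proof -
    obtain q where q: "q \<in> Q (Suc i)" "q \<notin> Q i" using Q(2)[OF \<open>i < m\<close>] by blast
    have "ideal (Q (Suc i)) S" using Q(1)[of "Suc i"] that primeideal.axioms(1) by force
    then have "q \<in> carrier S" using ideal.Icarr q(1) by metis
    then obtain x where "x \<in> carrier R" "h x = q" using surj by (metis imageE)
    then show ?thesis using q Q(2)[OF \<open>i < m\<close>] by blast
  qed
  moreover have "a_kernel R S h \<subseteq> ?P i" if "i \<le> m" for i
  proof -
    have "\<zero>\<^bsub>S\<^esub> \<in> Q i"
      using additive_subgroup.zero_closed ideal.axioms(1) primeideal.axioms(1) Q(1)[OF that] by blast
    then show ?thesis unfolding a_kernel_def' by auto
  qed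
  ultimately show "\<exists>P. prime_chain R m P \<and> (\<forall>i\<le>m. a_kernel R S h \<subseteq> P i)"
    by (intro exI[of _ ?P]) (simp add: prime_chain_def)
next
  assume "\<exists>P. prime_chain R m P \<and> (\<forall>i\<le>m. a_kernel R S h \<subseteq> P i)"
  then obtain P where P: "\<And>i. i \<le> m \<Longrightarrow> primeideal (P i) R" "\<And>i. i < m \<Longrightarrow> P i \<subset> P (Suc i)"
    and ker: "\<And>i. i \<le> m \<Longrightarrow> a_kernel R S h \<subseteq> P i"
    by (auto simp: prime_chain_def)
  note image = primeideal_image_surj[OF h R S surj P(1) ker]
  have "h ` P i \<subset> h ` P (Suc i)" if i: "i < m" for i
  proof
    show "h ` P i \<subseteq> h ` P (Suc i)" using P(2)[OF i] by blast
    have "i \<le> m" "Suc i \<le> m" using i by simp_all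
    then show "h ` P i \<noteq> h ` P (Suc i)"
      using P(2)[OF i] image(2)[of i] image(2)[of "Suc i"] by (metis psubset_eq)
  qed
  then show "\<exists>Q. prime_chain S m Q"
    using image(1) by (intro exI[of _ "\<lambda>i. h ` P i"]) (auto simp: prime_chain_def)
qed


section \<open>Chains of primes and the growth of an algebra\<close>

text \<open>
  A \<open>'k\<close>-algebra that is a domain, seen as a vector space so that dimensions can be counted.
\<close>
locale scalar_embedding =
  fixes \<iota> :: "'k::field \<Rightarrow> 'r::idom"
  assumes scalar_add: "\<iota> (a + b) = \<iota> a + \<iota> b"
    and scalar_mult: "\<iota> (a * b) = \<iota> a * \<iota> b"
    and scalar_one: "\<iota> 1 = 1"
begin

sublocale vector_space "\<lambda>c x. \<iota> c * x"
  by standard (simp_all add: scalar_add scalar_mult scalar_one algebra_simps)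

lemma scalar_zero: "\<iota> 0 = 0"
  using scale_zero_left[of 1] by simp

lemma scalar_uminus: "\<iota> (- a) = - \<iota> a"
  using scale_minus_left[of a 1] by simp

text \<open>
  Independence of a family is stronger than independence of its range, because it excludes
  repetitions.  This gives the cardinality of the range, which is what a dimension count needs.
\<close>
lemma independent_family:
  assumes W: "finite W"
    and indep: "\<And>c. (\<Sum>w\<in>W. \<iota> (c w) * g w) = 0 \<Longrightarrow> \<forall>w\<in>W. c w = 0"
  shows "inj_on g W" and "independent (g ` W)"
proof -
  show inj: "inj_on g W"
  proof (rule inj_onI, rule ccontr)
    fix u v assume uv: "u \<in> W" "v \<in> W" "g u = g v" "u \<noteq> v"
    let ?c = "\<lambda>w. if w = u then 1 else if w = v then - 1 else (0::'k)"
    have "(\<Sum>w\<in>W. \<iota> (?c w) * g w) = (\<Sum>w\<in>{u, v}. \<iota> (?c w) * g w)"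
      using uv W by (intro sum.mono_neutral_right) (auto simp: scalar_zero)
    also have "\<dots> = 0"
      using uv by (simp add: scalar_one scalar_uminus)
    finally have "?c u = 0" using indep[of ?c] uv(1) by blast
    then show False by simp
  qed
  show "independent (g ` W)"
  proof (rule independent_if_scalars_zero)
    fix f x assume *: "(\<Sum>x\<in>g ` W. \<iota> (f x) * x) = 0" and x: "x \<in> g ` W"
    have "(\<Sum>w\<in>W. \<iota> ((f \<circ> g) w) * g w) = 0"
      using * by (simp add: sum.reindex[OF inj])
    from indep[OF this] x show "f x = 0" by auto
  qed (use W in simp)
qed

lemma independent_mult_image:
  assumes "s \<noteq> 0" "finite A" "independent A"
  shows "independent ((\<lambda>x. s * x) ` A)" and "card ((\<lambda>x. s * x) ` A) = card A"
proof -
  have "\<forall>w\<in>A. c w = 0" if "(\<Sum>w\<in>A. \<iota> (c w) * (s * w)) = 0" for c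
  proof -
    have "s * (\<Sum>w\<in>A. \<iota> (c w) * w) = 0"
      using that by (simp add: sum_distrib_left mult_ac)
    then have "(\<Sum>w\<in>A. \<iota> (c w) * w) = 0" using assms(1) by simp
    then show ?thesis using independentD[OF assms(3,2) order_refl] by blast
  qed
  from independent_family[OF assms(2) this]
  show "independent ((\<lambda>x. s * x) ` A)" "card ((\<lambda>x. s * x) ` A) = card A"
    by (simp_all add: card_image)
qed

end

text \<open>
  One step in a chain of primes \<open>P \<subset> Q\<close>.  An element \<open>a\<close> of \<open>Q - P\<close> is transcendental modulo \<open>P\<close>
  over any coefficients that stay nonzero modulo \<open>Q\<close>: modulo \<open>Q\<close> only the constant coefficient
  of a relation survives, so it vanishes, and then a factor \<open>a \<notin> P\<close> can be cancelled.
\<close>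
lemma power_sum_in_primeideal:
  fixes B :: "'r::comm_ring_1 set"
  assumes B: "subring_set B"
    and P: "primeideal P (concrete_ring B)" and Q: "ideal Q (concrete_ring B)" and "P \<subseteq> Q"
    and a: "a \<in> Q" "a \<notin> P"
    and G: "\<And>j. G j \<in> B" "\<And>j. G j \<in> Q \<Longrightarrow> G j = 0"
    and sum: "(\<Sum>j<D. G j * a ^ j) \<in> P"
  shows "\<forall>j<D. G j = 0"
  using G sum
proof (induction D arbitrary: G)
  case (Suc D)
  note Pi = ideal_concrete_ringD[OF B primeideal_concrete_ringD(1)[OF B P]]
  note Qi = ideal_concrete_ringD[OF B Q]
  have aB: "a \<in> B" using a(1) Qi(1) by blast
  let ?r = "\<Sum>j<D. G (Suc j) * a ^ j"
  have r: "?r \<in> B"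
    by (intro subring_set_sum[OF B] subring_set_mult[OF B] subring_set_power[OF B] aB Suc.prems)
  have eq: "(\<Sum>j<Suc D. G j * a ^ j) = G 0 + a * ?r"
    by (subst sum.lessThan_Suc_shift) (simp add: sum_distrib_left mult_ac)
  have "a * ?r \<in> Q" using Qi(4)[OF a(1) r] by (simp add: mult.commute)
  then have "G 0 + a * ?r - a * ?r \<in> Q"
    using Suc.prems(3) \<open>P \<subseteq> Q\<close> eq by (intro Qi(6)) auto
  then have G0: "G 0 = 0" using Suc.prems(2)[of 0] by simp
  then have "a * ?r \<in> P" using Suc.prems(3) eq by simp
  then have "?r \<in> P" using primeideal_concrete_ringD(3)[OF B P aB r] a(2) by blast
  then have "\<forall>j<D. G (Suc j) = 0" using Suc.IH[of "\<lambda>j. G (Suc j)"] Suc.prems by blast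
  then show ?case using G0 by (metis less_Suc_eq_0_disj)
qed simp

definition words :: "nat \<Rightarrow> nat \<Rightarrow> nat list set" where
  "words D k = {l. set l \<subseteq> {..<D} \<and> length l = k}"

text \<open>
  A word \<open>[e\<^sub>0, e\<^sub>1, \<dots>]\<close> is an exponent vector, and its monomial is
  \<open>a\<^sub>i\<^bsup>e\<^sub>0\<^esup> a\<^sub>i\<^sub>+\<^sub>1\<^bsup>e\<^sub>1\<^esup> \<dots>\<close>.  The variable start index lets the recursion peel off the
  smallest prime of a chain first.
\<close>
primrec word_monomial :: "(nat \<Rightarrow> 'r::comm_ring_1) \<Rightarrow> nat \<Rightarrow> nat list \<Rightarrow> 'r" where
  "word_monomial a i [] = 1"
| "word_monomial a i (j # l) = word_monomial a (Suc i) l * a i ^ j"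

lemma finite_words: "finite (words D k)"
  unfolding words_def by (rule finite_lists_length_eq) simp

lemma card_words: "card (words D k) = D ^ k"
  unfolding words_def by (subst card_lists_length_eq) simp_all

lemma words_0: "words D 0 = {[]}"
  by (auto simp: words_def)

lemma sum_words_Suc:
  "(\<Sum>w\<in>words D (Suc k). f w) = (\<Sum>j<D. \<Sum>l\<in>words D k. f (j # l))"
proof -
  have inj: "inj_on (\<lambda>(l, j). j # l) (words D k \<times> {..<D})" by (auto simp: inj_on_def)
  have "(\<Sum>w\<in>words D (Suc k). f w) = (\<Sum>(l, j)\<in>words D k \<times> {..<D}. f (j # l))"
    unfolding words_def lists_length_Suc_eq
    using inj by (subst sum.reindex) (auto simp: words_def case_prod_beta)
  also have "\<dots> = (\<Sum>j<D. \<Sum>l\<in>words D k. f (j # l))"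
    by (subst sum.swap) (simp add: sum.cartesian_product)
  finally show ?thesis .
qed

context scalar_embedding
begin

text \<open>
  Elements \<open>a\<^sub>i \<in> P\<^sub>i\<^sub>+\<^sub>1 - P\<^sub>i\<close> picked along a chain of primes are algebraically independent.  The
  induction goes down the chain: a polynomial in \<open>a\<^sub>i, \<dots>, a\<^sub>m\<^sub>-\<^sub>1\<close> is a polynomial in \<open>a\<^sub>i\<close> whose
  coefficients are controlled modulo \<open>P\<^sub>i\<^sub>+\<^sub>1\<close> by the induction hypothesis, which is the situation
  of \<open>power_sum_in_primeideal\<close>.
\<close>
lemma prime_chain_monomials_independent:
  assumes B: "subring_set B" and scal: "\<And>c. \<iota> c \<in> B"
    and chain: "prime_chain (concrete_ring B) m P"
    and a: "\<And>i. i < m \<Longrightarrow> a i \<in> P (Suc i) - P i"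
    and "i + k = m" and "(\<Sum>w\<in>words D k. \<iota> (c w) * word_monomial a i w) \<in> P i"
  shows "\<forall>w\<in>words D k. c w = 0"
  using assms(5,6)
proof (induction k arbitrary: i c)
  case 0
  then have "i = m" by simp
  then have prime: "primeideal (P i) (concrete_ring B)" using chain by (simp add: prime_chain_def)
  have "\<iota> (c []) \<in> P i" using 0 by (simp add: words_0)
  then have "\<iota> (inverse (c [])) * \<iota> (c []) \<in> P i"
    using ideal_concrete_ringD(4)[OF B primeideal_concrete_ringD(1)[OF B prime]] scal by blast
  then have "\<iota> (inverse (c []) * c []) \<in> P i" by (simp add: scalar_mult)
  then have "c [] = 0"
    using primeideal_concrete_ringD(2)[OF B prime] scalar_one by (metis left_inverse)
  then show ?case by (simp add: words_0)
next
  case (Suc k)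
  then have i: "i < m" "Suc i + k = m" by simp_all
  have prime: "primeideal (P j) (concrete_ring B)" if "j \<le> m" for j
    using chain that by (simp add: prime_chain_def)
  have inB: "a j \<in> B" if "j < m" for j
    using a[OF that] that
      ideal_concrete_ringD(1)[OF B primeideal_concrete_ringD(1)[OF B prime[of "Suc j"]]] by auto
  have mon: "word_monomial a j l \<in> B" if "j + length l = m" for j l
    using that
  proof (induction l arbitrary: j)
    case (Cons x l)
    then show ?case
      by (auto intro!: subring_set_mult[OF B] subring_set_power[OF B] inB)
  qed (simp add: subring_set_one[OF B])
  define G where "G j = (\<Sum>l\<in>words D k. \<iota> (c (j # l)) * word_monomial a (Suc i) l)" for j
  have IH: "\<forall>l\<in>words D k. c (j # l) = 0" if "G j \<in> P (Suc i)" for j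
    using Suc.IH[OF i(2), of "\<lambda>l. c (j # l)"] that by (simp add: G_def)
  have "\<forall>j<D. G j = 0"
  proof (rule power_sum_in_primeideal[OF B prime])
    show "ideal (P (Suc i)) (concrete_ring B)"
      using primeideal_concrete_ringD(1)[OF B prime] i by simp
    show "P i \<subseteq> P (Suc i)" using chain i(1) unfolding prime_chain_def by blast
    show "a i \<in> P (Suc i)" "a i \<notin> P i" using a[OF i(1)] by auto
    show "G j \<in> B" for j unfolding G_def
      using i by (intro subring_set_sum[OF B] subring_set_mult[OF B] scal mon) (auto simp: words_def)
    show "G j = 0" if "G j \<in> P (Suc i)" for j
      using IH[OF that] by (simp add: G_def scalar_zero)
    show "(\<Sum>j<D. G j * a i ^ j) \<in> P i"
      using Suc.prems(2) by (simp add: sum_words_Suc G_def sum_distrib_right mult.assoc)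
  qed (use i in simp)
  moreover have "0 \<in> P (Suc i)"
    using ideal_concrete_ringD(2)[OF B primeideal_concrete_ringD(1)[OF B prime]] i by simp
  ultimately have "\<forall>j<D. \<forall>l\<in>words D k. c (j # l) = 0" using IH by simp
  then show ?case by (auto simp: words_def length_Suc_conv)
qed

text \<open>
  A bound on Krull dimension by growth.  If the algebra is exhausted, modulo the smallest prime, by
  a multiplicative filtration whose \<open>c\<close>-th piece has dimension at most \<open>(2 c + 1)\<^sup>d\<close>, then there is no
  room for more than \<open>d\<close> algebraically independent elements: \<open>D\<^sup>m\<close> independent monomials would lie in
  a piece whose dimension is only \<open>O(D\<^sup>d)\<close>.
\<close>
lemma prime_chain_length_le_growth:
  assumes B: "subring_set B" and scal: "\<And>c. \<iota> c \<in> B"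
    and chain: "prime_chain (concrete_ring B) m P"
    and X0: "1 \<in> X 0" and Xmono: "mono X"
    and Xmult: "\<And>c c' x y. x \<in> X c \<Longrightarrow> y \<in> X c' \<Longrightarrow> x * y \<in> X (c + c')"
    and growth: "\<And>c A. finite A \<Longrightarrow> independent A \<Longrightarrow> A \<subseteq> X c \<Longrightarrow> card A \<le> (2 * c + 1) ^ d"
    and exhaust: "\<And>x. x \<in> B \<Longrightarrow> \<exists>y\<in>B. (\<exists>c. y \<in> X c) \<and> x - y \<in> P 0"
  shows "m \<le> d"
proof -
  have prime: "primeideal (P j) (concrete_ring B)" if "j \<le> m" for j
    using chain that by (simp add: prime_chain_def)
  note ideal = primeideal_concrete_ringD(1)[OF B prime]
  have P0: "P 0 \<subseteq> P i" if "i \<le> m" for i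
    using that
  proof (induction i)
    case (Suc i)
    then have "P i \<subset> P (Suc i)" using chain by (simp add: prime_chain_def)
    with Suc show ?case by auto
  qed simp
  have "\<exists>y. y \<in> P (Suc i) - P i \<and> (\<exists>c. y \<in> X c)" if i: "i < m" for i
  proof -
    obtain x where x: "x \<in> P (Suc i)" "x \<notin> P i"
      using chain i unfolding prime_chain_def by blast
    moreover have "x \<in> B" using ideal_concrete_ringD(1)[OF B ideal] x(1) i by (metis Suc_leI subsetD)
    ultimately obtain y c where y: "y \<in> X c" "x - y \<in> P 0" using exhaust by blast
    have "x - y \<in> P i" "x - y \<in> P (Suc i)" 
      using P0[of i] P0[of "Suc i"] i y(2) by auto
    then have "x - (x - y) \<in> P (Suc i)"
      using ideal_concrete_ringD(6)[OF B ideal x(1)] i by (metis Suc_leI)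
    moreover have "x - y + y \<in> P i" if "y \<in> P i"
      using ideal_concrete_ringD(3)[OF B ideal \<open>x - y \<in> P i\<close> that] i by simp
    ultimately show ?thesis using x(2) y(1) by (metis Diff_iff diff_add_cancel diff_diff_eq2 add_diff_cancel_left')
  qed
  then obtain a c0 where a: "\<And>i. i < m \<Longrightarrow> a i \<in> P (Suc i) - P i"
    and c0: "\<And>i. i < m \<Longrightarrow> a i \<in> X (c0 i)" by metis
  define c where "c = (\<Sum>i<m. c0 i)"
  have c: "a i \<in> X c" if "i < m" for i
  proof -
    have "c0 i \<le> c" unfolding c_def using that by (intro member_le_sum) auto
    then show ?thesis using monoD[OF Xmono] c0[OF that] by blast
  qed
  have power: "x ^ j \<in> X (c * j)" if "x \<in> X c" for x j
    by (induction j) (use X0 Xmult that in \<open>auto\<close>)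
  have mon: "word_monomial a i l \<in> X (c * D * length l)"
    if "i + length l = m" "set l \<subseteq> {..<D}" for i l D
    using that
  proof (induction l arbitrary: i)
    case (Cons j l)
    have "a i ^ j \<in> X (c * j)" using power c Cons.prems by simp
    moreover have "c * j \<le> c * D" using Cons.prems by simp
    ultimately have "a i ^ j \<in> X (c * D)" using monoD[OF Xmono] by blast
    moreover have "word_monomial a (Suc i) l \<in> X (c * D * length l)" using Cons by simp
    ultimately have "word_monomial a (Suc i) l * a i ^ j \<in> X (c * D * length l + c * D)"
      using Xmult by blast
    then show ?case by (simp add: add.commute)
  qed (use X0 in simp)
  have bound: "D ^ m \<le> (2 * (c * D * m) + 1) ^ d" for D
  proof -
    have indep: "\<forall>w\<in>words D m. f w = 0"
      if "(\<Sum>w\<in>words D m. \<iota> (f w) * word_monomial a 0 w) = 0" for f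
      using prime_chain_monomials_independent[OF B scal chain a, where i = 0 and k = m and D = D and c = f] that
        ideal_concrete_ringD(2)[OF B ideal, of 0] by simp
    note fam = independent_family[OF finite_words indep]
    have "word_monomial a 0 ` words D m \<subseteq> X (c * D * m)"
      using mon[of 0] by (auto simp: words_def)
    from growth[OF _ fam(2) this] show ?thesis
      using fam(1) by (simp add: card_image card_words finite_words)
  qed
  show ?thesis
  proof (rule ccontr)
    assume "\<not> m \<le> d"
    \<comment> \<open>The dimension bound is at most \<open>(K * D)\<^sup>d\<close>, so \<open>D > K\<^sup>d\<close> makes \<open>D\<^sup>d\<^sup>+\<^sup>1\<close> exceed it.\<close>
    define K where "K = 2 * c * m + 1"
    define D where "D = K ^ d + 1"
    have "D ^ d * D \<le> D ^ m"
      using \<open>\<not> m \<le> d\<close> power_increasing[of "Suc d" m D] by (simp add: D_def mult.commute)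
    also have "\<dots> \<le> (2 * (c * D * m) + 1) ^ d" by (rule bound)
    also have "\<dots> \<le> (K * D) ^ d"
      by (rule power_mono) (simp_all add: K_def D_def algebra_simps)
    also have "\<dots> = D ^ d * K ^ d" by (simp add: power_mult_distrib)
    finally have "D \<le> K ^ d" by (simp add: D_def)
    then show False by (simp add: D_def)
  qed
qed

definition box_monomials :: "'v set \<Rightarrow> ('v \<Rightarrow> 'r) \<Rightarrow> nat \<Rightarrow> 'r set" where
  "box_monomials I b E = (\<lambda>e. \<Prod>v\<in>I. b v ^ e v) ` (I \<rightarrow>\<^sub>E {..E})"

lemma card_box_monomials:
  assumes "finite I"
  shows "finite (box_monomials I b E)" "card (box_monomials I b E) \<le> (E + 1) ^ card I"
proof -
  have fin: "finite (I \<rightarrow>\<^sub>E {..E})" using assms by (intro finite_PiE) auto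
  then show "finite (box_monomials I b E)" by (simp add: box_monomials_def)
  have "card (box_monomials I b E) \<le> card (I \<rightarrow>\<^sub>E {..E})"
    unfolding box_monomials_def using fin by (rule card_image_le)
  also have "\<dots> = (E + 1) ^ card I" using assms by (simp add: card_PiE)
  finally show "card (box_monomials I b E) \<le> (E + 1) ^ card I" .
qed

lemma box_monomials_mono: "E \<le> F \<Longrightarrow> box_monomials I b E \<subseteq> box_monomials I b F"
  unfolding box_monomials_def by (intro image_mono PiE_mono) auto

lemma one_in_box_monomials: "1 \<in> box_monomials I b E"
  unfolding box_monomials_def
  by (rule image_eqI[where x = "\<lambda>v\<in>I. 0"]) (auto intro: prod.neutral[symmetric])

lemma generator_in_box_monomials:
  assumes "finite I" "v \<in> I"
  shows "b v \<in> box_monomials I b 1"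
  unfolding box_monomials_def
proof (rule image_eqI[where x = "\<lambda>u\<in>I. if u = v then 1 else 0"])
  have "(\<Prod>u\<in>I. b u ^ (\<lambda>u\<in>I. if u = v then 1 else 0) u) = (\<Prod>u\<in>I. if u = v then b u else 1)"
    by (intro prod.cong) auto
  also have "\<dots> = b v" using assms by simp
  finally show "b v = (\<Prod>u\<in>I. b u ^ (\<lambda>u\<in>I. if u = v then 1 else 0) u)" ..
qed auto

lemma mult_box_monomials:
  assumes "x \<in> box_monomials I b E" "y \<in> box_monomials I b F"
  shows "x * y \<in> box_monomials I b (E + F)"
proof -
  from assms obtain e f where e: "e \<in> I \<rightarrow>\<^sub>E {..E}" "x = (\<Prod>v\<in>I. b v ^ e v)"
    and f: "f \<in> I \<rightarrow>\<^sub>E {..F}" "y = (\<Prod>v\<in>I. b v ^ f v)"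
    by (auto simp: box_monomials_def)
  show ?thesis unfolding box_monomials_def
  proof (rule image_eqI[where x = "\<lambda>v\<in>I. e v + f v"])
    show "x * y = (\<Prod>v\<in>I. b v ^ (\<lambda>v\<in>I. e v + f v) v)"
      by (simp add: e f power_add prod.distrib)
    show "(\<lambda>v\<in>I. e v + f v) \<in> I \<rightarrow>\<^sub>E {..E + F}"
      using e f by (auto simp: PiE_def Pi_def intro: add_mono)
  qed
qed

lemma mult_span_box_monomials:
  assumes x: "x \<in> span (box_monomials I b E)" and y: "y \<in> span (box_monomials I b F)"
  shows "x * y \<in> span (box_monomials I b (E + F))"
  using x
proof (induction rule: span_induct_alt)
  case base
  then show ?case by (simp add: span_zero)
next
  case (step c z x)
  have "z * y \<in> span (box_monomials I b (E + F))"
    using y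
  proof (induction rule: span_induct_alt)
    case base
    then show ?case by (simp add: span_zero)
  next
    case (step d u v)
    have "z * u \<in> box_monomials I b (E + F)"
      using mult_box_monomials \<open>z \<in> box_monomials I b E\<close> step(1) by blast
    then have "\<iota> d * (z * u) + z * v \<in> span (box_monomials I b (E + F))"
      using step(2) by (intro span_add span_scale[OF span_base])
    then show ?case by (simp add: algebra_simps)
  qed
  then have "\<iota> c * (z * y) + x * y \<in> span (box_monomials I b (E + F))"
    using step by (intro span_add span_scale)
  then show ?case by (simp add: algebra_simps)
qed

text \<open>
  Elements that become polynomials in the generators \<open>b\<close>, of degree at most \<open>2 c\<close> in each, after
  multiplication by \<open>b v ^ c\<close>.  The degree is twice the exponent because in the application one
  factor \<open>b v\<close> turns a further algebra generator into a quadratic expression in \<open>b\<close>.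
\<close>
definition cleared :: "'v set \<Rightarrow> ('v \<Rightarrow> 'r) \<Rightarrow> 'v \<Rightarrow> nat \<Rightarrow> 'r set" where
  "cleared I b v c = {x. b v ^ c * x \<in> span (box_monomials I b (2 * c))}"

lemma cleared_add: "x \<in> cleared I b v c \<Longrightarrow> y \<in> cleared I b v c \<Longrightarrow> x + y \<in> cleared I b v c"
  by (simp add: cleared_def distrib_left span_add)

lemma cleared_mult:
  assumes "x \<in> cleared I b v c" "y \<in> cleared I b v c'"
  shows "x * y \<in> cleared I b v (c + c')"
proof -
  have "(b v ^ c * x) * (b v ^ c' * y) \<in> span (box_monomials I b (2 * c + 2 * c'))"
    using assms by (intro mult_span_box_monomials) (auto simp: cleared_def)
  then show ?thesis by (simp add: cleared_def power_add algebra_simps)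
qed

lemma scalar_in_cleared_0: "\<iota> a \<in> cleared I b v 0"
  using span_scale[OF span_base[OF one_in_box_monomials], of a] by (simp add: cleared_def)

lemma one_in_cleared_0: "1 \<in> cleared I b v 0"
  using scalar_in_cleared_0[of 1] by (simp add: scalar_one)

lemma cleared_mono:
  assumes "finite I" "v \<in> I"
  shows "mono (cleared I b v)"
proof (rule monoI)
  have "b v * 1 \<in> span (box_monomials I b 2)"
    using box_monomials_mono[of 1 2 I b] generator_in_box_monomials[OF assms, of b]
    by (intro span_base) auto
  then have 1: "1 \<in> cleared I b v 1" by (simp add: cleared_def)
  fix c c' :: nat assume "c \<le> c'"
  then show "cleared I b v c \<subseteq> cleared I b v c'"
  proof (induction rule: dec_induct)
    case (step n)
    then show ?case using cleared_mult[OF _ 1, of _ n] by auto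
  qed simp
qed

lemma card_independent_cleared:
  assumes "finite I" "b v \<noteq> 0" "finite A" "independent A" "A \<subseteq> cleared I b v c"
  shows "card A \<le> (2 * c + 1) ^ card I"
proof -
  let ?A = "(\<lambda>x. b v ^ c * x) ` A"
  have "independent ?A" "card ?A = card A"
    using independent_mult_image[of "b v ^ c" A] assms by simp_all
  moreover have "?A \<subseteq> span (box_monomials I b (2 * c))" using assms(5) by (auto simp: cleared_def)
  ultimately have "card A \<le> card (box_monomials I b (2 * c))"
    using independent_span_bound[OF card_box_monomials(1)[OF assms(1)]] by metis
  also have "\<dots> \<le> (2 * c + 1) ^ card I" by (rule card_box_monomials) (fact assms(1))
  finally show ?thesis .
qed

end


section \<open>The Rees algebra and the special fiber\<close>

lemma ideal_ideal_power:
  assumes "cring R" "ideal J R"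
  shows "ideal (ideal_power R J k) R"
proof -
  interpret cring R by fact
  show ?thesis by (induction k) (auto intro: oneideal ideal_prod_is_ideal assms(2))
qed

text \<open>
  The reason why \<open>\<Oplus>\<^sub>k J\<^sup>k t\<^sup>k\<close> is closed under multiplication.
\<close>
lemma ideal_power_mult:
  assumes "cring R" "ideal J R" and x: "x \<in> ideal_power R J i" and y: "y \<in> ideal_power R J k"
  shows "x \<otimes>\<^bsub>R\<^esub> y \<in> ideal_power R J (i + k)"
proof -
  interpret cring R by fact
  note ideal = ideal_ideal_power[OF assms(1,2)]
  have xc: "x \<in> carrier R" using ideal.Icarr[OF ideal x] .
  show ?thesis
    using y
  proof (induction k arbitrary: y)
    case 0
    then show ?case using ideal.I_r_closed[OF ideal x] by simp
  next
    case (Suc k)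
    from Suc.prems have "y \<in> ideal_prod R (ideal_power R J k) J" by simp
    then have "x \<otimes>\<^bsub>R\<^esub> y \<in> ideal_prod R (ideal_power R J (i + k)) J"
    proof (induction rule: ideal_prod.induct)
      case (prod a b)
      have "a \<in> carrier R" "b \<in> carrier R"
        using ideal.Icarr[OF ideal] ideal.Icarr[OF assms(2)] prod by auto
      then have "x \<otimes>\<^bsub>R\<^esub> (a \<otimes>\<^bsub>R\<^esub> b) = (x \<otimes>\<^bsub>R\<^esub> a) \<otimes>\<^bsub>R\<^esub> b" using xc by (simp add: m_assoc)
      then show ?case using Suc.IH[OF prod(1)] prod(2) by (auto intro: ideal_prod.prod)
    next
      case (sum a b)
      have "ideal_prod R (ideal_power R J k) J \<subseteq> carrier R"
        by (rule ideal_prod_in_carrier[OF ideal assms(2)])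
      then have "a \<in> carrier R" "b \<in> carrier R" using sum by auto
      then have "x \<otimes>\<^bsub>R\<^esub> (a \<oplus>\<^bsub>R\<^esub> b) = (x \<otimes>\<^bsub>R\<^esub> a) \<oplus>\<^bsub>R\<^esub> (x \<otimes>\<^bsub>R\<^esub> b)" using xc by (simp add: r_distr)
      then show ?case using sum by (auto intro: ideal_prod.sum)
    qed
    then show ?case by simp
  qed
qed

text \<open>
  The Rees algebra as a set of elements of the type of univariate polynomials; \<open>coeff_ring_iso\<close>
  identifies it with \<open>rees_algebra\<close>, whose elements are coefficient functions.
\<close>
definition rees_set :: "'a::comm_ring_1 set \<Rightarrow> 'a set \<Rightarrow> 'a poly set" where
  "rees_set C J = {p. \<forall>k. Polynomial.coeff p k \<in> ideal_power (concrete_ring C) J k}"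

context
  fixes C :: "'a::comm_ring_1 set" and J :: "'a set"
  assumes C: "subring_set C" and J: "ideal J (concrete_ring C)"
begin

lemma ideal_power_concrete_ring: "ideal (ideal_power (concrete_ring C) J k) (concrete_ring C)"
  by (rule ideal_ideal_power[OF cring_concrete_ring[OF C] J])

lemmas ideal_power_concrete_ringD = ideal_concrete_ringD[OF C ideal_power_concrete_ring]

lemma ideal_power_sum:
  "(\<And>i. i \<in> A \<Longrightarrow> f i \<in> ideal_power (concrete_ring C) J k)
    \<Longrightarrow> sum f A \<in> ideal_power (concrete_ring C) J k"
  by (induction A rule: infinite_finite_induct)
    (auto intro: ideal_power_concrete_ringD(2,3))

lemma const_in_rees_set: "c \<in> C \<Longrightarrow> [:c:] \<in> rees_set C J"
  using ideal_power_concrete_ringD(2)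
  by (auto simp: rees_set_def coeff_pCons simp del: ideal_power.simps(2) split: nat.splits)

lemma monom_in_rees_set: "x \<in> J \<Longrightarrow> Polynomial.monom x 1 \<in> rees_set C J"
proof -
  assume "x \<in> J"
  then have "1 * x \<in> ideal_power (concrete_ring C) J 1"
    using ideal_prod.prod[of 1 C x J "concrete_ring C"] subring_set_one[OF C] by simp
  then show ?thesis
    using ideal_power_concrete_ringD(2) by (simp add: rees_set_def del: ideal_power.simps)
qed

lemma subring_set_rees_set: "subring_set (rees_set C J)"
  unfolding subring_set_def
proof (intro conjI ballI)
  show "1 \<in> rees_set C J"
    using const_in_rees_set[OF subring_set_one[OF C]] by (simp add: one_pCons)
  fix p q assume p: "p \<in> rees_set C J" and q: "q \<in> rees_set C J"
  then show "p - q \<in> rees_set C J"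
    by (auto simp: rees_set_def intro: ideal_power_concrete_ringD(6))
  have "Polynomial.coeff p i * Polynomial.coeff q (k - i) \<in> ideal_power (concrete_ring C) J k"
    if "i \<le> k" for i k
    using ideal_power_mult[OF cring_concrete_ring[OF C] J, of "Polynomial.coeff p i" i
        "Polynomial.coeff q (k - i)" "k - i"] p q that by (simp add: rees_set_def)
  then show "p * q \<in> rees_set C J"
    by (auto simp: rees_set_def Polynomial.coeff_mult intro: ideal_power_sum)
qed

lemma rees_set_coeff_in: "p \<in> rees_set C J \<Longrightarrow> Polynomial.coeff p k \<in> C"
  using ideal_power_concrete_ringD(1) by (auto simp: rees_set_def)

lemma coeff_in_up: "p \<in> rees_set C J \<Longrightarrow> Polynomial.coeff p \<in> up (concrete_ring C)"
  by (rule mem_upI)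
    (auto simp: rees_set_coeff_in coeff_eq_0 intro!: exI[of _ "Polynomial.degree p"])

lemma rees_algebra_simps:
  "carrier (rees_algebra (concrete_ring C) J) =
     {f \<in> up (concrete_ring C). \<forall>k. f k \<in> ideal_power (concrete_ring C) J k}"
  "monoid.mult (rees_algebra (concrete_ring C) J) = monoid.mult (UP (concrete_ring C))"
  "monoid.one (rees_algebra (concrete_ring C) J) = monoid.one (UP (concrete_ring C))"
  "ring.zero (rees_algebra (concrete_ring C) J) = ring.zero (UP (concrete_ring C))"
  "ring.add (rees_algebra (concrete_ring C) J) = ring.add (UP (concrete_ring C))"
  by (auto simp: rees_algebra_def UP_def)

lemma coeff_ring_iso:
  "Polynomial.coeff \<in> ring_iso (concrete_ring (rees_set C J)) (rees_algebra (concrete_ring C) J)"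
proof (rule ring_iso_memI)
  let ?R = "rees_algebra (concrete_ring C) J"
  fix p assume "p \<in> carrier (concrete_ring (rees_set C J))"
  then have p: "p \<in> rees_set C J" by simp
  then show "Polynomial.coeff p \<in> carrier ?R"
    using coeff_in_up by (auto simp: rees_algebra_simps rees_set_def)
  fix q assume "q \<in> carrier (concrete_ring (rees_set C J))"
  then have q: "q \<in> rees_set C J" by simp
  have "(\<Oplus>\<^bsub>concrete_ring C\<^esub>i\<in>{..n}. Polynomial.coeff p i * Polynomial.coeff q (n - i))
      = Polynomial.coeff (p * q) n" for n
    unfolding Polynomial.coeff_mult
    by (rule finsum_concrete_ring[OF C])
      (auto intro: subring_set_mult[OF C] rees_set_coeff_in p q)
  then show "Polynomial.coeff (p \<otimes>\<^bsub>concrete_ring (rees_set C J)\<^esub> q) =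
      Polynomial.coeff p \<otimes>\<^bsub>?R\<^esub> Polynomial.coeff q"
    by (auto simp: rees_algebra_simps UP_def coeff_in_up p q)
  show "Polynomial.coeff (p \<oplus>\<^bsub>concrete_ring (rees_set C J)\<^esub> q) =
      Polynomial.coeff p \<oplus>\<^bsub>?R\<^esub> Polynomial.coeff q"
    by (auto simp: rees_algebra_simps UP_def coeff_in_up p q)
next
  let ?R = "rees_algebra (concrete_ring C) J"
  show "Polynomial.coeff \<one>\<^bsub>concrete_ring (rees_set C J)\<^esub> = \<one>\<^bsub>?R\<^esub>"
    by (auto simp: rees_algebra_simps UP_def)
  show "bij_betw Polynomial.coeff (carrier (concrete_ring (rees_set C J))) (carrier ?R)"
    unfolding bij_betw_def
  proof
    show "inj_on Polynomial.coeff (carrier (concrete_ring (rees_set C J)))"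
      by (auto simp: inj_on_def poly_eq_iff)
    have "f \<in> Polynomial.coeff ` rees_set C J" if f: "f \<in> carrier ?R" for f
    proof -
      from f obtain n where "bound 0 n f" by (auto simp: rees_algebra_simps up_def)
      then have "Polynomial.coeff (Abs_poly f) = f" by (intro coeff_Abs_poly) auto
      then show ?thesis using f by (intro image_eqI[of _ _ "Abs_poly f"])
        (auto simp: rees_algebra_simps rees_set_def)
    qed
    then show "Polynomial.coeff ` carrier (concrete_ring (rees_set C J)) = carrier ?R"
      using coeff_in_up by (auto simp: rees_algebra_simps rees_set_def)
  qed
qed

lemma cring_rees_algebra: "cring (rees_algebra (concrete_ring C) J)"
proof -
  let ?R = "rees_algebra (concrete_ring C) J"
  interpret cring "concrete_ring (rees_set C J)"
    by (rule cring_concrete_ring[OF subring_set_rees_set])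
  have "cring (?R \<lparr> ring.zero := Polynomial.coeff \<zero>\<^bsub>concrete_ring (rees_set C J)\<^esub> \<rparr>)"
    by (rule ring_iso_imp_img_cring[OF coeff_ring_iso])
  moreover have "Polynomial.coeff \<zero>\<^bsub>concrete_ring (rees_set C J)\<^esub> = ring.zero ?R"
    by (auto simp: rees_algebra_simps UP_def)
  ultimately show ?thesis by simp
qed

text \<open>
  The Krull dimension of the special fiber is thereby a question about primes of the Rees algebra
  that contain the generators \<open>M\<close> of the kernel of the quotient map.
\<close>
lemma special_fiber_prime_chain_iff:
  assumes M: "M \<subseteq> C"
  shows "(\<exists>Q. prime_chain (special_fiber (concrete_ring C) M J) m Q) \<longleftrightarrow>
     (\<exists>P. prime_chain (concrete_ring (rees_set C J)) m P \<and> (\<forall>i\<le>m. \<forall>s\<in>M. [:s:] \<in> P i))"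
proof -
  let ?B = "concrete_ring (rees_set C J)" and ?R = "rees_algebra (concrete_ring C) J"
  define N where "N = (\<lambda>a. up_ring.monom (UP (concrete_ring C)) a 0) ` M"
  define I where "I = Idl\<^bsub>?R\<^esub> N"
  define h where "h = (\<lambda>p. I +>\<^bsub>?R\<^esub> Polynomial.coeff p)"
  interpret B: cring ?B by (rule cring_concrete_ring[OF subring_set_rees_set])
  interpret R: cring ?R by (rule cring_rees_algebra)
  have coeff_hom: "Polynomial.coeff \<in> ring_hom ?B ?R"
    using coeff_ring_iso by (simp add: ring_iso_def)
  have coeff_surj: "Polynomial.coeff ` carrier ?B = carrier ?R"
    using coeff_ring_iso by (auto simp: ring_iso_def bij_betw_def)
  have mono: "up_ring.monom (UP (concrete_ring C)) s 0 = Polynomial.coeff [:s:]" if "s \<in> M" for s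
    using that M by (auto simp: UP_def fun_eq_iff coeff_pCons split: nat.splits)
  have N: "N = (\<lambda>s. Polynomial.coeff [:s:]) ` M"
    unfolding N_def by (rule image_cong) (simp_all add: mono)
  have constR: "[:s:] \<in> carrier ?B" if "s \<in> M" for s
    using const_in_rees_set that M by auto
  have NR: "N \<subseteq> carrier ?R" unfolding N coeff_surj[symmetric] using constR by auto
  have idealI: "ideal I ?R" unfolding I_def by (rule R.genideal_ideal[OF NR])
  have NI: "N \<subseteq> I" unfolding I_def by (rule R.genideal_self[OF NR])
  have fiber: "special_fiber (concrete_ring C) M J = ?R Quot I"
    by (simp add: special_fiber_def I_def N_def)
  have hom: "h \<in> ring_hom ?B (?R Quot I)"
    using ring_hom_trans[OF coeff_hom ideal.rcos_ring_hom[OF idealI]] by (simp add: h_def comp_def)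
  have Quot: "cring (?R Quot I)" by (rule ideal.quotient_is_cring[OF idealI cring_rees_algebra])
  have hom_ring: "ring_hom_ring ?B (?R Quot I) h"
    using hom Quot B.ring_axioms cring.axioms(1) by (intro ring_hom_ringI2) auto
  have surj: "h ` carrier ?B = carrier (?R Quot I)"
  proof -
    have "h ` carrier ?B = (\<lambda>x. I +>\<^bsub>?R\<^esub> x) ` (Polynomial.coeff ` carrier ?B)"
      by (simp add: h_def image_image)
    also have "\<dots> = carrier (?R Quot I)"
      unfolding coeff_surj by (auto simp: FactRing_def A_RCOSETS_def')
    finally show ?thesis .
  qed
  have kernel: "a_kernel ?B (?R Quot I) h = {p \<in> rees_set C J. Polynomial.coeff p \<in> I}"
  proof -
    have "h p = \<zero>\<^bsub>?R Quot I\<^esub> \<longleftrightarrow> Polynomial.coeff p \<in> I" if "p \<in> rees_set C J" for p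
    proof -
      have "Polynomial.coeff p \<in> carrier ?R" using coeff_surj that by auto
      then show ?thesis
        using R.a_rcos_zero[OF idealI] ideal.rcos_const_imp_mem[OF idealI]
        unfolding h_def by (auto simp: FactRing_def)
    qed
    then show ?thesis unfolding a_kernel_def' concrete_ring_simps by blast
  qed
  have kernel_le: "a_kernel ?B (?R Quot I) h \<subseteq> P \<longleftrightarrow> (\<forall>s\<in>M. [:s:] \<in> P)" if P: "ideal P ?B" for P
  proof
    assume "a_kernel ?B (?R Quot I) h \<subseteq> P"
    then show "\<forall>s\<in>M. [:s:] \<in> P"
      using NI constR unfolding kernel N by auto
  next
    assume *: "\<forall>s\<in>M. [:s:] \<in> P"
    have "ring_hom_ring ?B ?R Polynomial.coeff"
      using coeff_hom B.ring_axioms R.ring_axioms by (intro ring_hom_ringI2)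
    from ideal_image_surj[OF this coeff_surj P] have "ideal (Polynomial.coeff ` P) ?R" .
    then have "I \<subseteq> Polynomial.coeff ` P"
      unfolding I_def by (rule R.genideal_minimal) (use * in \<open>auto simp: N\<close>)
    then show "a_kernel ?B (?R Quot I) h \<subseteq> P" by (auto simp: kernel coeff_inject)
  qed
  have "(\<exists>Q. prime_chain (?R Quot I) m Q) \<longleftrightarrow>
      (\<exists>P. prime_chain ?B m P \<and> (\<forall>i\<le>m. a_kernel ?B (?R Quot I) h \<subseteq> P i))"
    using prime_chain_surj_iff[OF hom_ring _ Quot surj] B.is_cring by blast
  also have "\<dots> \<longleftrightarrow> (\<exists>P. prime_chain ?B m P \<and> (\<forall>i\<le>m. \<forall>s\<in>M. [:s:] \<in> P i))"
  proof -
    have "(\<forall>i\<le>m. a_kernel ?B (?R Quot I) h \<subseteq> P i) \<longleftrightarrow> (\<forall>i\<le>m. \<forall>s\<in>M. [:s:] \<in> P i)"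
      if "prime_chain ?B m P" for P
    proof -
      have "ideal (P i) ?B" if "i \<le> m" for i
        using \<open>prime_chain ?B m P\<close> that primeideal.axioms(1) unfolding prime_chain_def by blast
      then show ?thesis using kernel_le by blast
    qed
    then show ?thesis by blast
  qed
  finally show ?thesis by (simp add: fiber)
qed

text \<open>
  The Rees algebra is generated as a ring by the constants and the elements \<open>g t\<close>, for \<open>g\<close> in a
  generating set of \<open>J\<close>.  In this form the fact serves as an induction principle.
\<close>
lemma rees_set_subset:
  assumes J_gen: "J = Idl\<^bsub>concrete_ring C\<^esub> G" and G: "G \<subseteq> C"
    and add: "\<And>x y. x \<in> D \<Longrightarrow> y \<in> D \<Longrightarrow> x + y \<in> D"
    and mult: "\<And>x y. x \<in> D \<Longrightarrow> y \<in> D \<Longrightarrow> x * y \<in> D"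
    and const: "\<And>c. c \<in> C \<Longrightarrow> [:c:] \<in> D"
    and gen: "\<And>g. g \<in> G \<Longrightarrow> Polynomial.monom g 1 \<in> D"
  shows "rees_set C J \<subseteq> D"
proof -
  interpret cring "concrete_ring C" by (rule cring_concrete_ring[OF C])
  have zero: "0 \<in> D" using const[OF subring_set_zero[OF C]] by simp
  have "ideal {x \<in> C. Polynomial.monom x 1 \<in> D} (concrete_ring C)"
  proof (rule ideal_concrete_ringI[OF C])
    fix x c assume x: "x \<in> {x \<in> C. Polynomial.monom x 1 \<in> D}" and c: "c \<in> C"
    have "[:c:] * Polynomial.monom x 1 \<in> D" by (rule mult) (use x c const in auto)
    then show "c * x \<in> {x \<in> C. Polynomial.monom x 1 \<in> D}"
      using x c by (auto simp: smult_monom intro: subring_set_mult[OF C])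
  qed (use zero add in \<open>auto simp: subring_set_zero[OF C] subring_set_add[OF C] add_monom[symmetric]\<close>)
  then have 1: "J \<subseteq> {x \<in> C. Polynomial.monom x 1 \<in> D}"
    unfolding J_gen by (rule genideal_minimal) (use G gen in auto)
  have monom: "Polynomial.monom x k \<in> D" if "x \<in> ideal_power (concrete_ring C) J k" for x k
    using that
  proof (induction k arbitrary: x)
    case 0
    then show ?case using const by (simp add: monom_0)
  next
    case (Suc k)
    from Suc.prems have "x \<in> ideal_prod (concrete_ring C) (ideal_power (concrete_ring C) J k) J" by simp
    then show ?case
    proof (induction rule: ideal_prod.induct)
      case (prod a b)
      have "Polynomial.monom a k * Polynomial.monom b 1 \<in> D"
        using Suc.IH[OF prod(1)] 1 prod(2) mult by auto
      then show ?case by (simp add: mult_monom)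
    next
      case (sum a b)
      then show ?case using add by (simp add: add_monom[symmetric])
    qed
  qed
  have sum: "sum f A \<in> D" if "\<And>i. i \<in> A \<Longrightarrow> f i \<in> D" for f and A :: "nat set"
    using that by (induction A rule: infinite_finite_induct) (auto intro: zero add)
  show ?thesis
  proof
    fix p assume "p \<in> rees_set C J"
    then have "(\<Sum>i\<le>Polynomial.degree p. Polynomial.monom (Polynomial.coeff p i) i) \<in> D"
      by (intro sum monom) (auto simp: rees_set_def)
    then show "p \<in> D" by (simp add: poly_as_sum_of_monoms)
  qed
qed

end


section \<open>Polynomials in several variables and their evaluation\<close>

text \<open>
  The order on the variables induces one on the monomials under which the leading monomial of a
  product is the product of the leading monomials; this is how polynomials in these variables are
  seen to form a domain.
\<close>
primrec xyvar_index :: "xyvar \<Rightarrow> nat" where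
  "xyvar_index (XVar i) = 2 * i"
| "xyvar_index (YVar i) = 2 * i + 1"

lemma inj_xyvar_index: "xyvar_index u = xyvar_index v \<Longrightarrow> u = v"
  by (cases u; cases v) (auto dest: arg_cong[where f = even])

instantiation xyvar :: linorder
begin

definition "u \<le> v \<longleftrightarrow> xyvar_index u \<le> xyvar_index v"
definition "u < v \<longleftrightarrow> xyvar_index u < xyvar_index v"

instance
  by standard (auto simp: less_eq_xyvar_def less_xyvar_def intro: inj_xyvar_index)

end

definition mpolys :: "'v set \<Rightarrow> ('v, 'k::field) mpoly set" where
  "mpolys V = {p. \<forall>m \<in> Poly_Mapping.keys p. Poly_Mapping.keys m \<subseteq> V}"

lemma mpoly_ring_eq: "mpoly_ring V = concrete_ring (mpolys V)"
  by (simp add: mpoly_ring_def concrete_ring_def mpolys_def)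

lemma subring_set_mpolys: "subring_set (mpolys V)"
  unfolding subring_set_def
proof (intro conjI ballI)
  show "1 \<in> mpolys V" by (simp add: mpolys_def)
  fix p q :: "('a, 'b) mpoly" assume p: "p \<in> mpolys V" and q: "q \<in> mpolys V"
  show "p - q \<in> mpolys V" using p q keys_diff[of p q] by (auto simp: mpolys_def)
  show "p * q \<in> mpolys V" unfolding mpolys_def
  proof (safe)
    fix m v assume "m \<in> Poly_Mapping.keys (p * q)" and v: "v \<in> Poly_Mapping.keys m"
    then obtain a b where "m = a + b" "a \<in> Poly_Mapping.keys p" "b \<in> Poly_Mapping.keys q"
      using keys_mult[of p q] by blast
    then show "v \<in> V" using v p q keys_add[of a b] by (fastforce simp: mpolys_def)
  qed
qed

lemma mvar_in_mpolys: "v \<in> V \<Longrightarrow> mvar v \<in> mpolys V"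
  by (auto simp: mvar_def mpolys_def split: if_splits)

lemma mconst_in_mpolys: "Poly_Mapping.single 0 c \<in> mpolys V"
  by (auto simp: mpolys_def split: if_splits)

lemma mpoly_sum_monomials:
  "p = (\<Sum>m\<in>Poly_Mapping.keys p. Poly_Mapping.single m (Poly_Mapping.lookup p m))"
proof (rule poly_mapping_eqI)
  fix k
  have "Poly_Mapping.lookup (\<Sum>m\<in>Poly_Mapping.keys p. Poly_Mapping.single m (Poly_Mapping.lookup p m)) k
     = (\<Sum>m\<in>Poly_Mapping.keys p. if m = k then Poly_Mapping.lookup p m else 0)"
    by (auto simp: lookup_sum lookup_single when_def intro!: sum.cong)
  also have "\<dots> = Poly_Mapping.lookup p k" by (simp add: in_keys_iff)
  finally show "Poly_Mapping.lookup p k = Poly_Mapping.lookup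
      (\<Sum>m\<in>Poly_Mapping.keys p. Poly_Mapping.single m (Poly_Mapping.lookup p m)) k" ..
qed

lemma ideal_hom_max_ideal: "ideal (hom_max_ideal V) (concrete_ring (mpolys V))"
  unfolding hom_max_ideal_def mpoly_ring_eq
  by (rule ring.genideal_ideal[OF cring.axioms(1)[OF cring_concrete_ring[OF subring_set_mpolys]]])
    (auto intro: mvar_in_mpolys)

lemma hom_max_ideal_subset: "hom_max_ideal V \<subseteq> mpolys V"
  using ideal_concrete_ringD(1)[OF subring_set_mpolys ideal_hom_max_ideal] .

lemma hom_max_ideal_minimal:
  assumes "ideal I (concrete_ring (mpolys V))" "mvar ` V \<subseteq> I"
  shows "hom_max_ideal V \<subseteq> I"
  unfolding hom_max_ideal_def mpoly_ring_eq
  by (rule ring.genideal_minimal[OF cring.axioms(1)[OF cring_concrete_ring[OF subring_set_mpolys]] assms])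

text \<open>
  A polynomial equals its constant term modulo the maximal ideal, so that modulo this ideal the
  Rees algebra is generated over the field itself.
\<close>
lemma minus_const_in_hom_max_ideal:
  assumes p: "p \<in> mpolys V"
  shows "p - Poly_Mapping.single 0 (Poly_Mapping.lookup p 0) \<in> hom_max_ideal V"
proof -
  note I = ideal_concrete_ringD[OF subring_set_mpolys ideal_hom_max_ideal]
  have mvar: "mvar v \<in> hom_max_ideal V" if "v \<in> V" for v
  proof -
    interpret cring "concrete_ring (mpolys V)"
      by (rule cring_concrete_ring[OF subring_set_mpolys])
    have "mvar ` V \<subseteq> carrier (concrete_ring (mpolys V))"
      by (auto intro: mvar_in_mpolys)
    from genideal_self[OF this] that show ?thesis
      unfolding hom_max_ideal_def mpoly_ring_eq by blast
  qed
  let ?t = "\<lambda>m. Poly_Mapping.single m (Poly_Mapping.lookup p m)"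
  have monom: "?t m \<in> hom_max_ideal V" if m: "m \<in> Poly_Mapping.keys p - {0}" for m
  proof -
    obtain v where v: "v \<in> Poly_Mapping.keys m" using m by (metis DiffD2 all_not_in_conv keys_eq_empty singletonI)
    then have vV: "v \<in> V" using m p by (auto simp: mpolys_def)
    let ?m' = "m - Poly_Mapping.single v 1"
    have "m = ?m' + Poly_Mapping.single v 1"
      by (rule poly_mapping_eqI) (use v in \<open>auto simp: lookup_add lookup_minus lookup_single when_def in_keys_iff\<close>)
    then have eq: "?t m = Poly_Mapping.single ?m' (Poly_Mapping.lookup p m) * mvar v"
      by (simp add: mvar_def mult_single)
    have "Poly_Mapping.keys ?m' \<subseteq> Poly_Mapping.keys m"
      by (auto simp: in_keys_iff lookup_minus)
    then have "Poly_Mapping.single ?m' (Poly_Mapping.lookup p m) \<in> mpolys V"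
      using m p by (auto simp: mpolys_def split: if_splits)
    then show ?thesis unfolding eq using I(4)[OF mvar[OF vV]] by blast
  qed
  have "sum ?t A \<in> hom_max_ideal V" if "A \<subseteq> Poly_Mapping.keys p - {0}" for A
    using that by (induction A rule: infinite_finite_induct) (auto intro: I(2,3) monom)
  then have *: "sum ?t (Poly_Mapping.keys p - {0}) \<in> hom_max_ideal V" by blast
  have "p = sum ?t (Poly_Mapping.keys p)" by (rule mpoly_sum_monomials)
  also have "\<dots> = sum ?t (insert 0 (Poly_Mapping.keys p))"
    by (intro sum.mono_neutral_left) (auto simp: in_keys_iff)
  also have "\<dots> = ?t 0 + sum ?t (Poly_Mapping.keys p - {0})"
    by (subst sum.insert_remove) simp_all
  finally have "p - ?t 0 = sum ?t (Poly_Mapping.keys p - {0})" by (simp add: algebra_simps)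
  then show ?thesis using * by simp
qed

definition monomial_eval :: "('v \<Rightarrow> 'r::comm_ring_1) \<Rightarrow> ('v \<Rightarrow>\<^sub>0 nat) \<Rightarrow> 'r" where
  "monomial_eval \<xi> m = (\<Prod>v\<in>Poly_Mapping.keys m. \<xi> v ^ Poly_Mapping.lookup m v)"

lemma monomial_eval_superset:
  assumes "finite A" "Poly_Mapping.keys m \<subseteq> A"
  shows "monomial_eval \<xi> m = (\<Prod>v\<in>A. \<xi> v ^ Poly_Mapping.lookup m v)"
  unfolding monomial_eval_def using assms
  by (intro prod.mono_neutral_left) (auto simp: in_keys_iff)

lemma monomial_eval_add: "monomial_eval \<xi> (m + m') = monomial_eval \<xi> m * monomial_eval \<xi> m'"
proof -
  let ?A = "Poly_Mapping.keys m \<union> Poly_Mapping.keys m'"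
  have "monomial_eval \<xi> (m + m') = (\<Prod>v\<in>?A. \<xi> v ^ Poly_Mapping.lookup (m + m') v)"
    using keys_add[of m m'] by (intro monomial_eval_superset) auto
  also have "\<dots> = (\<Prod>v\<in>?A. \<xi> v ^ Poly_Mapping.lookup m v) * (\<Prod>v\<in>?A. \<xi> v ^ Poly_Mapping.lookup m' v)"
    by (simp add: lookup_add power_add prod.distrib)
  also have "\<dots> = monomial_eval \<xi> m * monomial_eval \<xi> m'"
    by (simp add: monomial_eval_superset[of ?A])
  finally show ?thesis .
qed

context scalar_embedding
begin

definition mpoly_eval :: "('v \<Rightarrow> 'r) \<Rightarrow> ('v, 'k) mpoly \<Rightarrow> 'r" where
  "mpoly_eval \<xi> p =
     (\<Sum>m\<in>Poly_Mapping.keys p. \<iota> (Poly_Mapping.lookup p m) * monomial_eval \<xi> m)"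

lemma mpoly_eval_superset:
  assumes "finite A" "Poly_Mapping.keys p \<subseteq> A"
  shows "mpoly_eval \<xi> p = (\<Sum>m\<in>A. \<iota> (Poly_Mapping.lookup p m) * monomial_eval \<xi> m)"
  unfolding mpoly_eval_def using assms
  by (intro sum.mono_neutral_left) (auto simp: in_keys_iff scalar_zero)

lemma mpoly_eval_add: "mpoly_eval \<xi> (p + q) = mpoly_eval \<xi> p + mpoly_eval \<xi> q"
proof -
  let ?A = "Poly_Mapping.keys p \<union> Poly_Mapping.keys q"
  have "mpoly_eval \<xi> (p + q) = (\<Sum>m\<in>?A. \<iota> (Poly_Mapping.lookup (p + q) m) * monomial_eval \<xi> m)"
    using keys_add[of p q] by (intro mpoly_eval_superset) auto
  also have "\<dots> = (\<Sum>m\<in>?A. \<iota> (Poly_Mapping.lookup p m) * monomial_eval \<xi> m)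
      + (\<Sum>m\<in>?A. \<iota> (Poly_Mapping.lookup q m) * monomial_eval \<xi> m)"
    by (simp add: lookup_add scalar_add distrib_right sum.distrib)
  also have "\<dots> = mpoly_eval \<xi> p + mpoly_eval \<xi> q"
    by (simp add: mpoly_eval_superset[of ?A])
  finally show ?thesis .
qed

lemma mpoly_eval_0 [simp]: "mpoly_eval \<xi> 0 = 0"
  by (simp add: mpoly_eval_def)

lemma mpoly_eval_diff: "mpoly_eval \<xi> (p - q) = mpoly_eval \<xi> p - mpoly_eval \<xi> q"
  using mpoly_eval_add[of \<xi> "p - q" q] by simp

lemma mpoly_eval_sum: "mpoly_eval \<xi> (sum f A) = (\<Sum>x\<in>A. mpoly_eval \<xi> (f x))"
  by (induction A rule: infinite_finite_induct) (auto simp: mpoly_eval_add)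

lemma mpoly_eval_single: "mpoly_eval \<xi> (Poly_Mapping.single m c) = \<iota> c * monomial_eval \<xi> m"
  by (subst mpoly_eval_superset[of "{m}"]) auto

lemma mpoly_eval_const: "mpoly_eval \<xi> (Poly_Mapping.single 0 c) = \<iota> c"
  by (simp add: mpoly_eval_single monomial_eval_def)

lemma mpoly_eval_1: "mpoly_eval \<xi> 1 = 1"
  using mpoly_eval_const[of \<xi> 1] by (simp add: scalar_one)

lemma mpoly_eval_mvar: "mpoly_eval \<xi> (mvar v) = \<xi> v"
  by (simp add: mvar_def mpoly_eval_single scalar_one monomial_eval_superset[of "{v}"])

lemma mpoly_eval_mult: "mpoly_eval \<xi> (p * q) = mpoly_eval \<xi> p * mpoly_eval \<xi> q"
proof -
  let ?t = "\<lambda>p m. Poly_Mapping.single m (Poly_Mapping.lookup p m)"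
  have "p * q = (\<Sum>m\<in>Poly_Mapping.keys p. \<Sum>m'\<in>Poly_Mapping.keys q. ?t p m * ?t q m')"
    by (subst mpoly_sum_monomials[of p], subst mpoly_sum_monomials[of q]) (rule sum_product)
  then have "mpoly_eval \<xi> (p * q) = (\<Sum>m\<in>Poly_Mapping.keys p. \<Sum>m'\<in>Poly_Mapping.keys q.
      mpoly_eval \<xi> (?t p m * ?t q m'))"
    by (simp add: mpoly_eval_sum)
  also have "\<dots> = (\<Sum>m\<in>Poly_Mapping.keys p. \<Sum>m'\<in>Poly_Mapping.keys q.
      mpoly_eval \<xi> (?t p m) * mpoly_eval \<xi> (?t q m'))"
    by (simp add: mult_single mpoly_eval_single monomial_eval_add scalar_mult mult_ac)
  also have "\<dots> = mpoly_eval \<xi> p * mpoly_eval \<xi> q"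
    by (simp add: sum_product[symmetric] mpoly_eval_sum[symmetric] mpoly_sum_monomials[symmetric])
  finally show ?thesis .
qed

lemma hom_mpoly_eval:
  assumes add: "\<And>x y. \<phi> (x + y) = \<phi> x + \<phi> y" and mult: "\<And>x y. \<phi> (x * y) = \<phi> x * \<phi> y"
    and const: "\<And>c. \<phi> (\<iota> c) = \<iota> c"
  shows "\<phi> (mpoly_eval (\<xi> :: 'v \<Rightarrow> 'r) p) = mpoly_eval (\<lambda>v. \<phi> (\<xi> v)) p"
proof -
  have zero: "\<phi> 0 = 0" using const[of 0] by (simp add: scalar_zero)
  have one: "\<phi> 1 = 1" using const[of 1] by (simp add: scalar_one)
  have sum: "\<phi> (sum f A) = (\<Sum>x\<in>A. \<phi> (f x))" for f :: "('v \<Rightarrow>\<^sub>0 nat) \<Rightarrow> 'r" and A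
    by (induction A rule: infinite_finite_induct) (auto simp: zero add)
  have prod: "\<phi> (prod f A) = (\<Prod>x\<in>A. \<phi> (f x))" for f :: "'v \<Rightarrow> 'r" and A
    by (induction A rule: infinite_finite_induct) (auto simp: one mult)
  have power: "\<phi> (x ^ k) = \<phi> x ^ k" for x k by (induction k) (auto simp: one mult)
  show ?thesis
    by (simp add: mpoly_eval_def monomial_eval_def sum mult prod power const)
qed

end

lemma scalar_embedding_mconst:
  "scalar_embedding (Poly_Mapping.single 0 :: 'k::field \<Rightarrow> ('v::linorder, 'k) mpoly)"
  by standard (simp_all add: single_add mult_single)

lemma scalar_embedding_poly:
  assumes "scalar_embedding \<iota>"
  shows "scalar_embedding (\<lambda>c. [:\<iota> c:])"
proof -
  interpret scalar_embedding \<iota> by fact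
  show ?thesis by standard (simp_all add: scalar_add scalar_mult scalar_one one_pCons)
qed


section \<open>Maximal minors and the Pluecker relation\<close>

definition maximal_minor :: "nat \<Rightarrow> nat \<Rightarrow> (xyvar, 'k::field) mpoly" where
  "maximal_minor i j = mvar (XVar i) * mvar (YVar j) - mvar (XVar j) * mvar (YVar i)"

text \<open>
  The edge condition admits both orderings of the endpoints, as the edge ideal does, so that this is
  literally its generating set.
\<close>
definition edge_minors :: "nat \<Rightarrow> (xyvar, 'k::field) mpoly set" where
  "edge_minors n = {maximal_minor i j | i j. {i, j} \<in> complete_graph_edges n}"

definition minor_ideal :: "nat \<Rightarrow> (xyvar, 'k::field) mpoly set" where
  "minor_ideal n = Idl\<^bsub>concrete_ring (mpolys (xyvars n))\<^esub> (edge_minors n)"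

lemma binomial_edge_ideal_complete_graph:
  "binomial_edge_ideal n (complete_graph_edges n) = minor_ideal n"
  by (simp add: binomial_edge_ideal_def minor_ideal_def edge_minors_def maximal_minor_def mpoly_ring_eq)

lemma complete_graph_edgesD: "{i, j} \<in> complete_graph_edges n \<Longrightarrow> i \<in> {1..n} \<and> j \<in> {1..n}"
  by (auto simp: complete_graph_edges_def doubleton_eq_iff)

lemma maximal_minor_in_edge_minors:
  assumes "1 \<le> i" "i < j" "j \<le> n"
  shows "maximal_minor i j \<in> edge_minors n"
  using assms by (auto simp: edge_minors_def complete_graph_edges_def)

lemma edge_minors_subset: "edge_minors n \<subseteq> (mpolys (xyvars n) :: (xyvar, 'k::field) mpoly set)"
proof
  fix g :: "(xyvar, 'k) mpoly" assume "g \<in> edge_minors n"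
  then obtain i j where g: "g = maximal_minor i j" and "i \<in> {1..n}" "j \<in> {1..n}"
    by (auto simp: edge_minors_def dest: complete_graph_edgesD)
  then have "mvar (XVar l) \<in> mpolys (xyvars n)" "mvar (YVar l) \<in> mpolys (xyvars n)"
    if "l = i \<or> l = j" for l
    using that by (auto simp: xyvars_def intro!: mvar_in_mpolys)
  then show "g \<in> mpolys (xyvars n)" unfolding g maximal_minor_def
    by (intro subring_set_diff[OF subring_set_mpolys] subring_set_mult[OF subring_set_mpolys]) auto
qed

lemma ideal_minor_ideal: "ideal (minor_ideal n) (concrete_ring (mpolys (xyvars n)))"
  unfolding minor_ideal_def
  by (rule ring.genideal_ideal[OF cring.axioms(1)[OF cring_concrete_ring[OF subring_set_mpolys]]])
    (simp add: edge_minors_subset)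

lemma edge_minors_subset_minor_ideal: "edge_minors n \<subseteq> minor_ideal n"
  unfolding minor_ideal_def
  by (rule ring.genideal_self[OF cring.axioms(1)[OF cring_concrete_ring[OF subring_set_mpolys]]])
    (simp add: edge_minors_subset)

text \<open>
  The minors indexed by these pairs are coordinates of the affine cone over the Grassmannian where
  the \<open>12\<close>-minor is invertible.
\<close>
definition plucker_index :: "nat \<Rightarrow> (nat \<times> nat) set" where
  "plucker_index n = insert (1, 2) (Pair 1 ` {3..n} \<union> Pair 2 ` {3..n})"

lemma plucker_index: "finite (plucker_index n)" "(1, 2) \<in> plucker_index n"
  "n \<ge> 2 \<Longrightarrow> card (plucker_index n) = 2 * n - 3"
proof -
  show "finite (plucker_index n)" "(1, 2) \<in> plucker_index n" by (auto simp: plucker_index_def)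
  have "card (Pair 1 ` {3..n} \<union> Pair (2::nat) ` {3..n}) = (n - 2) + (n - 2)"
    by (subst card_Un_disjoint) (auto simp: card_image inj_on_def)
  then show "card (plucker_index n) = 2 * n - 3" if "n \<ge> 2"
    using that unfolding plucker_index_def by (subst card_insert_disjoint) auto
qed

context scalar_embedding
begin

text \<open>
  The three-term Pluecker relation solves for \<open>T i j\<close> after division by \<open>T 1 2\<close>, so every minor is in the
  first piece of the filtration.
\<close>
lemma plucker_cleared:
  fixes T :: "nat \<Rightarrow> nat \<Rightarrow> 'r"
  assumes anti: "\<And>i j. T j i = - T i j" and diag: "\<And>i. T i i = 0"
    and plucker: "\<And>i j. T 1 2 * T i j = T 1 i * T 2 j - T 1 j * T 2 i"
    and "i \<in> {1..n}" "j \<in> {1..n}"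
  shows "T i j \<in> cleared (plucker_index n) (\<lambda>(i, j). T i j) (1, 2) 1"
proof -
  let ?W = "\<lambda>E. span (box_monomials (plucker_index n) (\<lambda>(i, j). T i j) E)"
  have gen: "T k l \<in> ?W 1" if "(k, l) \<in> plucker_index n" for k l
    using generator_in_box_monomials[OF plucker_index(1) that, of "\<lambda>(i, j). T i j"]
    by (auto intro: span_base)
  have row1: "T 1 l \<in> ?W 1" if l: "l \<in> {1..n}" for l
  proof -
    consider "l = 1" | "l = 2" | "l \<in> {3..n}" using l by fastforce
    then show ?thesis
    proof cases
      case 1 then show ?thesis by (simp add: diag span_zero)
    next
      case 2 then show ?thesis using gen[OF plucker_index(2)] by simp
    next
      case 3
      then have "(1, l) \<in> plucker_index n" by (simp add: plucker_index_def)
      then show ?thesis by (rule gen)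
    qed
  qed
  have row2: "T 2 l \<in> ?W 1" if l: "l \<in> {1..n}" for l
  proof -
    consider "l = 1" | "l = 2" | "l \<in> {3..n}" using l by fastforce
    then show ?thesis
    proof cases
      case 1
      have "- T 1 2 \<in> ?W 1" using gen[OF plucker_index(2)] by (rule span_neg)
      then show ?thesis using 1 anti[of 2 1] by simp
    next
      case 2 then show ?thesis by (simp add: diag span_zero)
    next
      case 3
      then have "(2, l) \<in> plucker_index n" by (simp add: plucker_index_def)
      then show ?thesis by (rule gen)
    qed
  qed
  have "T 1 i * T 2 j - T 1 j * T 2 i \<in> ?W (1 + 1)"
    using assms(4,5) by (intro span_diff mult_span_box_monomials row1 row2)
  then have "T 1 2 * T i j \<in> ?W 2" by (simp only: plucker one_add_one)
  then show ?thesis by (simp add: cleared_def)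
qed

end

section \<open>Specialisations of a row reduced matrix and the lower bound\<close>

text \<open>
  The entries of the matrix with columns \<open>(x\<^sub>1, 0), (0, 1), (x\<^sub>3, y\<^sub>3), \<dots>, (x\<^sub>n, y\<^sub>n)\<close>.  Row operations
  of determinant \<open>1\<close>, which preserve all maximal minors, bring a generic \<open>2 \<times> n\<close> matrix to this shape
  over its field of fractions.  There are \<open>2 n - 3\<close> free entries, and the minors include \<open>x\<^sub>1\<close>,
  \<open>x\<^sub>1 y\<^sub>j\<close> and \<open>- x\<^sub>j\<close>.
\<close>
definition reduced_entry :: "xyvar \<Rightarrow> (xyvar, 'k::field) mpoly" where
  "reduced_entry v = (if v \<in> {YVar 1, XVar 2} then 0 else if v = YVar 2 then 1 else mvar v)"

interpretation mconst: scalar_embedding "Poly_Mapping.single 0 :: 'k::field \<Rightarrow> (xyvar, 'k) mpoly"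
  by (rule scalar_embedding_mconst)

interpretation pconst: scalar_embedding
  "\<lambda>c :: 'k::field. [:Poly_Mapping.single 0 c :: (xyvar, 'k) mpoly:]"
  by (rule scalar_embedding_poly[OF scalar_embedding_mconst])

text \<open>
  Evaluation at the reduced matrix, with a new variable that records the degree of the source: a form
  of degree \<open>k\<close> goes to a multiple of the \<open>k\<close>-th power of this variable.
\<close>
definition graded_eval :: "(xyvar, 'k::field) mpoly \<Rightarrow> (xyvar, 'k) mpoly poly" where
  "graded_eval = pconst.mpoly_eval (\<lambda>v. Polynomial.monom (reduced_entry v) 1)"

lemmas graded_eval_simps =
  pconst.mpoly_eval_add[of "\<lambda>v. Polynomial.monom (reduced_entry v) 1", folded graded_eval_def]
  pconst.mpoly_eval_diff[of "\<lambda>v. Polynomial.monom (reduced_entry v) 1", folded graded_eval_def]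
  pconst.mpoly_eval_mult[of "\<lambda>v. Polynomial.monom (reduced_entry v) 1", folded graded_eval_def]
  pconst.mpoly_eval_0[of "\<lambda>v. Polynomial.monom (reduced_entry v) 1", folded graded_eval_def]
  pconst.mpoly_eval_1[of "\<lambda>v. Polynomial.monom (reduced_entry v) 1", folded graded_eval_def]
  pconst.mpoly_eval_mvar[of "\<lambda>v. Polynomial.monom (reduced_entry v) 1", folded graded_eval_def]

lemma graded_eval_maximal_minor:
  "graded_eval (maximal_minor i j) = Polynomial.monom
     (reduced_entry (XVar i) * reduced_entry (YVar j) - reduced_entry (XVar j) * reduced_entry (YVar i)) 2"
  by (simp add: maximal_minor_def graded_eval_simps mult_monom diff_monom numeral_2_eq_2)

lemma maximal_minor_12_neq_0: "maximal_minor 1 2 \<noteq> (0 :: (xyvar, 'k::field) mpoly)"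
proof
  assume *: "maximal_minor 1 2 = (0 :: (xyvar, 'k) mpoly)"
  have "Polynomial.monom (mvar (XVar 1) :: (xyvar, 'k) mpoly) 2 = graded_eval (maximal_minor 1 2)"
    unfolding graded_eval_maximal_minor by (simp add: reduced_entry_def)
  then have "Polynomial.monom (mvar (XVar 1) :: (xyvar, 'k) mpoly) 2 = 0"
    unfolding * by (simp add: graded_eval_simps)
  then show False by (simp add: mvar_def monom_eq_0_iff) (metis lookup_single_eq lookup_zero zero_neq_one)
qed

definition kill :: "xyvar set \<Rightarrow> (xyvar, 'k::field) mpoly \<Rightarrow> (xyvar, 'k) mpoly" where
  "kill Z = mconst.mpoly_eval (\<lambda>v. if v \<in> Z then 0 else mvar v)"

lemma kill_simps:
  "kill Z (p + q) = kill Z p + kill Z q"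
  "kill Z (p - q) = kill Z p - kill Z q"
  "kill Z (- p) = - kill Z p"
  "kill Z (p * q) = kill Z p * kill Z q"
  "kill Z 0 = 0" "kill Z 1 = 1"
  "kill Z (mvar v) = (if v \<in> Z then 0 else mvar v)"
  "kill Z (Poly_Mapping.single 0 c) = Poly_Mapping.single 0 c"
  unfolding kill_def using mconst.mpoly_eval_diff[of _ 0 p]
  by (simp_all add: mconst.mpoly_eval_add mconst.mpoly_eval_diff mconst.mpoly_eval_mult
      mconst.mpoly_eval_1 mconst.mpoly_eval_mvar mconst.mpoly_eval_const)

text \<open>
  Killing more variables factors through killing fewer, which is why the kernels below increase.
\<close>
lemma kill_kill:
  assumes "Z \<subseteq> Z'"
  shows "kill Z' (kill Z p) = kill Z' p"
proof -
  have "kill Z' (kill Z p) = mconst.mpoly_eval (\<lambda>v. kill Z' (if v \<in> Z then 0 else mvar v)) p"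
    unfolding kill_def[of Z] by (rule mconst.hom_mpoly_eval) (simp_all add: kill_simps)
  also have "(\<lambda>v. kill Z' (if v \<in> Z then 0 else mvar v)) = (\<lambda>v. if v \<in> Z' then 0 else mvar v)"
    by (rule ext) (use assms in \<open>auto simp: kill_simps\<close>)
  finally show ?thesis by (simp add: kill_def)
qed

text \<open>
  An element of \<open>J\<^sup>k\<close> has no terms of degree below \<open>2 k\<close>, and modulo the maximal ideal only its part of degree
  \<open>2 k\<close> matters.  Sending each coefficient \<open>p\<^sub>k \<in> J\<^sup>k\<close> to the value of this part at the reduced matrix
  therefore defines a homomorphism on the special fiber.
\<close>
definition initial_coeff ::
    "(xyvar, 'k::field) mpoly poly \<Rightarrow> nat \<Rightarrow> (xyvar, 'k) mpoly" where
  "initial_coeff p k = Polynomial.coeff (graded_eval (Polynomial.coeff p k)) (2 * k)"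

text \<open>
  The variable \<open>t\<close> of the Rees algebra is kept, so that multiplicativity is a matter of single
  coefficients.
\<close>
definition initial_eval :: "xyvar set \<Rightarrow>
    (xyvar, 'k::field) mpoly poly \<Rightarrow> (xyvar, 'k) mpoly poly" where
  "initial_eval Z p = Abs_poly (\<lambda>k. kill Z (initial_coeff p k))"

lemma coeff_initial_eval: "Polynomial.coeff (initial_eval Z p) k = kill Z (initial_coeff p k)"
  unfolding initial_eval_def
  by (subst coeff_Abs_poly[of "Polynomial.degree p"])
    (simp_all add: initial_coeff_def coeff_eq_0 graded_eval_simps kill_simps)

text \<open>
  The minors are quadrics, hence elements of \<open>J\<^sup>k\<close> have order at least \<open>2 k\<close>.
\<close>
lemma dvd_graded_eval_ideal_power:
  assumes "x \<in> ideal_power (concrete_ring (mpolys (xyvars n))) (minor_ideal n) k"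
  shows "Polynomial.monom 1 (2 * k) dvd graded_eval x"
  using assms
proof (induction k arbitrary: x)
  case (Suc k)
  let ?C = "concrete_ring (mpolys (xyvars n))"
  have "ideal {x \<in> mpolys (xyvars n). Polynomial.monom 1 2 dvd graded_eval x} ?C"
    by (rule ideal_concrete_ringI[OF subring_set_mpolys])
      (auto simp: graded_eval_simps subring_set_zero[OF subring_set_mpolys]
        intro: subring_set_add[OF subring_set_mpolys] subring_set_mult[OF subring_set_mpolys])
  moreover have "Polynomial.monom 1 2 dvd graded_eval g" if "g \<in> edge_minors n" for g
    using that by (auto simp: edge_minors_def graded_eval_maximal_minor monom_1_dvd_iff')
  ultimately have J: "minor_ideal n \<subseteq> {x. Polynomial.monom 1 2 dvd graded_eval x}"
    using ring.genideal_minimal[OF cring.axioms(1)[OF cring_concrete_ring[OF subring_set_mpolys]],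
        of "{x \<in> mpolys (xyvars n). Polynomial.monom 1 2 dvd graded_eval x}" "xyvars n" "edge_minors n"]
      edge_minors_subset[of n]
    unfolding minor_ideal_def by blast
  from Suc.prems have "x \<in> ideal_prod ?C (ideal_power ?C (minor_ideal n) k) (minor_ideal n)" by simp
  then show ?case
  proof (induction rule: ideal_prod.induct)
    case (prod a b)
    have "Polynomial.monom 1 (2 * k) * Polynomial.monom 1 2 dvd graded_eval a * graded_eval b"
      using Suc.IH[OF prod(1)] J prod(2) by (intro mult_dvd_mono) auto
    then show ?case by (simp add: graded_eval_simps mult_monom add.commute)
  qed (simp add: graded_eval_simps)
qed simp

text \<open>
  Passing to the lowest admissible degree is multiplicative because there is nothing in lower
  degrees that could contribute.
\<close>
lemma initial_coeff_mult:
  assumes p: "p \<in> rees_set (mpolys (xyvars n)) (minor_ideal n)"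
    and q: "q \<in> rees_set (mpolys (xyvars n)) (minor_ideal n)"
  shows "initial_coeff (p * q) k = (\<Sum>i\<le>k. initial_coeff p i * initial_coeff q (k - i))"
proof -
  have "Polynomial.coeff (graded_eval (Polynomial.coeff p i * Polynomial.coeff q (k - i))) (2 * k)
      = initial_coeff p i * initial_coeff q (k - i)" if "i \<le> k" for i
  proof -
    have "Polynomial.monom 1 (2 * i) dvd graded_eval (Polynomial.coeff p i)"
      "Polynomial.monom 1 (2 * (k - i)) dvd graded_eval (Polynomial.coeff q (k - i))"
      using p q by (auto simp: rees_set_def intro!: dvd_graded_eval_ideal_power)
    then obtain a b where a: "graded_eval (Polynomial.coeff p i) = Polynomial.monom 1 (2 * i) * a"
      and b: "graded_eval (Polynomial.coeff q (k - i)) = Polynomial.monom 1 (2 * (k - i)) * b"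
      by (auto elim!: dvdE)
    have "graded_eval (Polynomial.coeff p i * Polynomial.coeff q (k - i))
        = (Polynomial.monom 1 (2 * i) * Polynomial.monom 1 (2 * (k - i))) * (a * b)"
      by (simp only: graded_eval_simps a b mult_ac)
    also have "\<dots> = Polynomial.monom 1 (2 * k) * (a * b)"
    proof -
      have "2 * i + 2 * (k - i) = 2 * k" using that by simp
      then show ?thesis by (simp add: mult_monom)
    qed
    finally show ?thesis
      by (simp add: initial_coeff_def a b Polynomial.coeff_monom_mult Polynomial.coeff_mult_0)
  qed
  moreover have "graded_eval (sum f A) = (\<Sum>x\<in>A. graded_eval (f x))"
    for f :: "nat \<Rightarrow> (xyvar, 'a) mpoly" and A
    by (induction A rule: infinite_finite_induct) (auto simp: graded_eval_simps)
  ultimately show ?thesis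
    by (simp add: initial_coeff_def Polynomial.coeff_mult coeff_sum)
qed

definition fiber_prime :: "nat \<Rightarrow> xyvar set \<Rightarrow> (xyvar, 'k::field) mpoly poly set" where
  "fiber_prime n Z =
     {p \<in> rees_set (mpolys (xyvars n)) (minor_ideal n). initial_eval Z p = 0}"

lemma primeideal_fiber_prime:
  "primeideal (fiber_prime n Z) (concrete_ring (rees_set (mpolys (xyvars n)) (minor_ideal n)))"
  unfolding fiber_prime_def
proof (rule primeideal_kernel[OF subring_set_rees_set[OF subring_set_mpolys ideal_minor_ideal]])
  show "initial_eval Z 1 = 1"
    by (rule poly_eqI)
      (auto simp: coeff_initial_eval initial_coeff_def graded_eval_simps kill_simps)
  fix p q :: "(xyvar, 'a) mpoly poly"
  assume p: "p \<in> rees_set (mpolys (xyvars n)) (minor_ideal n)"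
    and q: "q \<in> rees_set (mpolys (xyvars n)) (minor_ideal n)"
  show "initial_eval Z (p + q) = initial_eval Z p + initial_eval Z q"
    by (rule poly_eqI)
      (simp add: coeff_initial_eval initial_coeff_def graded_eval_simps kill_simps)
  have kill_sum: "kill Z (sum f A) = (\<Sum>x\<in>A. kill Z (f x))"
    for f :: "nat \<Rightarrow> (xyvar, 'a) mpoly" and A
    by (induction A rule: infinite_finite_induct) (auto simp: kill_simps)
  show "initial_eval Z (p * q) = initial_eval Z p * initial_eval Z q"
    by (rule poly_eqI)
      (simp add: coeff_initial_eval initial_coeff_mult[OF p q] kill_sum kill_simps Polynomial.coeff_mult)
qed

lemma fiber_prime_mono:
  assumes "Z \<subseteq> Z'"
  shows "fiber_prime n Z \<subseteq> fiber_prime n Z'"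
proof -
  have "kill Z' x = 0" if "kill Z x = 0" for x :: "(xyvar, 'a) mpoly"
    using kill_kill[OF assms, of x] that by (simp add: kill_simps)
  then show ?thesis by (auto simp: fiber_prime_def poly_eq_iff coeff_initial_eval)
qed

text \<open>
  In degree \<open>0\<close> of the Rees algebra the lowest part is the constant term, which vanishes on the maximal
  ideal.
\<close>
lemma hom_max_ideal_in_fiber_prime:
  assumes "s \<in> hom_max_ideal (xyvars n)"
  shows "[:s:] \<in> fiber_prime n Z"
proof -
  have "ideal {x \<in> mpolys (xyvars n). Polynomial.coeff (graded_eval x) 0 = 0}
      (concrete_ring (mpolys (xyvars n)))"
    by (rule ideal_concrete_ringI[OF subring_set_mpolys])
      (auto simp: graded_eval_simps Polynomial.coeff_mult_0 subring_set_zero[OF subring_set_mpolys]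
        intro: subring_set_add[OF subring_set_mpolys] subring_set_mult[OF subring_set_mpolys])
  then have "hom_max_ideal (xyvars n) \<subseteq>
      {x \<in> mpolys (xyvars n). Polynomial.coeff (graded_eval x) 0 = 0}"
    by (rule hom_max_ideal_minimal) (auto simp: graded_eval_simps mvar_in_mpolys)
  then have "s \<in> mpolys (xyvars n)" "Polynomial.coeff (graded_eval s) 0 = 0" using assms by auto
  then show ?thesis
    using const_in_rees_set[OF subring_set_mpolys ideal_minor_ideal]
    by (auto simp: fiber_prime_def poly_eq_iff coeff_initial_eval initial_coeff_def coeff_pCons
        graded_eval_simps kill_simps split: nat.splits)
qed

lemma monom_edge_minor_in_rees_set:
  "g \<in> edge_minors n \<Longrightarrow> Polynomial.monom g 1 \<in> rees_set (mpolys (xyvars n)) (minor_ideal n)"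
  using edge_minors_subset_minor_ideal
  by (intro monom_in_rees_set[OF subring_set_mpolys ideal_minor_ideal]) blast

lemma monom_maximal_minor_in_fiber_prime_iff:
  assumes "1 \<le> i" "i < j" "j \<le> n"
  shows "Polynomial.monom (maximal_minor i j :: (xyvar, 'k::field) mpoly) 1 \<in> fiber_prime n Z \<longleftrightarrow>
    kill Z (reduced_entry (XVar i) * reduced_entry (YVar j) - reduced_entry (XVar j) * reduced_entry (YVar i))
      = (0 :: (xyvar, 'k) mpoly)"
  using monom_edge_minor_in_rees_set[OF maximal_minor_in_edge_minors[OF assms]]
  by (auto simp: fiber_prime_def poly_eq_iff coeff_initial_eval initial_coeff_def
      graded_eval_simps kill_simps graded_eval_maximal_minor)

lemma mvar_neq_0: "mvar v \<noteq> (0 :: ('v, 'k::field) mpoly)"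
  by (metis lookup_single_eq lookup_zero mvar_def zero_neq_one)

text \<open>
  The free entries of the reduced matrix in the order in which they are set to zero.  The entry
  \<open>x\<^sub>1\<close> has to be the last one, as \<open>y\<^sub>j\<close> is visible only through the minor \<open>x\<^sub>1 y\<^sub>j\<close>.
\<close>
definition kill_order :: "nat \<Rightarrow> xyvar list" where
  "kill_order n = map XVar [3..<n + 1] @ map YVar [3..<n + 1] @ [XVar 1]"

lemma kill_order: "distinct (kill_order n)" "n \<ge> 2 \<Longrightarrow> length (kill_order n) = 2 * n - 3"
  by (auto simp: kill_order_def distinct_map inj_on_def)

text \<open>
  Each newly killed entry is, up to sign and the factor \<open>x\<^sub>1\<close> not yet killed, the value of a minor \<open>f\<close>,
  and \<open>f t\<close> then separates the two primes.
\<close>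
lemma fiber_prime_strict:
  fixes n i :: nat
  assumes n: "n \<ge> 2" and i: "i < 2 * n - 3"
  defines "Z \<equiv> \<lambda>i. set (take i (kill_order n))"
  shows "(fiber_prime n (Z i) :: (xyvar, 'k::field) mpoly poly set) \<subset> fiber_prime n (Z (Suc i))"
proof -
  have len: "i < length (kill_order n)" using i kill_order(2)[OF n] by simp
  let ?v = "kill_order n ! i"
  have Suc: "Z (Suc i) = insert ?v (Z i)"
    unfolding Z_def by (simp add: take_Suc_conv_app_nth[OF len])
  have "distinct (take (Suc i) (kill_order n))" using kill_order(1) by (rule distinct_take)
  then have notin: "?v \<notin> Z i"
    unfolding Z_def by (simp add: take_Suc_conv_app_nth[OF len])
  have sub: "fiber_prime n (Z i) \<subseteq> fiber_prime n (Z (Suc i))"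
    by (rule fiber_prime_mono) (auto simp: Suc)
  have "\<exists>k j. 1 \<le> k \<and> k < j \<and> j \<le> n \<and>
     (Polynomial.monom (maximal_minor k j :: (xyvar, 'k) mpoly) 1 \<in> fiber_prime n (Z (Suc i))) \<and>
     (Polynomial.monom (maximal_minor k j :: (xyvar, 'k) mpoly) 1 \<notin> fiber_prime n (Z i))"
  proof -
    note in_fiber = monom_maximal_minor_in_fiber_prime_iff[unfolded One_nat_def]
    have "?v \<in> set (kill_order n)" using len by (rule nth_mem)
    then consider (s) "?v = XVar 1" | (X) j where "?v = XVar j" "3 \<le> j" "j \<le> n"
      | (Y) j where "?v = YVar j" "3 \<le> j" "j \<le> n"
      unfolding kill_order_def by fastforce
    then show ?thesis
    proof cases
      case s
      then show ?thesis using notin n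
        by - (rule exI[of _ 1], rule exI[of _ 2], simp add: in_fiber reduced_entry_def kill_simps Suc mvar_neq_0)
    next
      case X
      then show ?thesis using notin
        by - (rule exI[of _ 2], rule exI[of _ j], simp add: in_fiber reduced_entry_def kill_simps Suc mvar_neq_0)
    next
      case Y
      have "XVar 1 \<notin> Z i"
      proof
        assume "XVar 1 \<in> Z i"
        then obtain l where l: "l < i" "kill_order n ! l = XVar 1"
          unfolding Z_def using len by (auto simp: in_set_conv_nth)
        have last: "kill_order n ! (2 * n - 4) = XVar 1" "2 * n - 4 < length (kill_order n)"
          using n kill_order(2)[OF n] by (auto simp: kill_order_def nth_append)
        have "l = 2 * n - 4"
          using nth_eq_iff_index_eq[OF kill_order(1), of l n "2 * n - 4"] l last len by simp
        then show False using l i by simp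
      qed
      then show ?thesis using notin Y
        by - (rule exI[of _ 1], rule exI[of _ j], simp add: in_fiber reduced_entry_def kill_simps Suc mvar_neq_0)
    qed
  qed
  then show ?thesis using sub by blast
qed

section \<open>The analytic spread\<close>

text \<open>
  Modulo the smallest prime of the chain, which contains the maximal ideal, every element of the Rees algebra
  is a polynomial over \<open>'k\<close> in the elements \<open>T i j = f\<^sub>i\<^sub>j t\<close>.  The Pluecker relation puts these into the
  filtration \<open>cleared\<close> on \<open>2 n - 3\<close> generators, and the growth bound applies.
\<close>
lemma prime_chain_upper:
  fixes P :: "nat \<Rightarrow> (xyvar, 'k::field) mpoly poly set"
  assumes n: "n \<ge> 2"
    and chain: "prime_chain (concrete_ring (rees_set (mpolys (xyvars n)) (minor_ideal n))) m P"
    and max: "\<And>s. s \<in> hom_max_ideal (xyvars n) \<Longrightarrow> [:s:] \<in> P 0"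
  shows "m \<le> 2 * n - 3"
proof -
  let ?C = "mpolys (xyvars n)"
  let ?B = "rees_set ?C (minor_ideal n)"
  define T :: "nat \<Rightarrow> nat \<Rightarrow> (xyvar, 'k) mpoly poly" where
    "T i j = Polynomial.monom (maximal_minor i j) 1" for i j
  let ?b = "\<lambda>(i, j). T i j"
  let ?X = "pconst.cleared (plucker_index n) ?b (1, 2)"
  note sub = subring_set_mpolys[of "xyvars n"] and J = ideal_minor_ideal[of n]
  note B = subring_set_rees_set[OF sub J]
  have prime: "primeideal (P 0) (concrete_ring ?B)" using chain by (simp add: prime_chain_def)
  note P0 = ideal_concrete_ringD[OF B primeideal_concrete_ringD(1)[OF B prime]]
  have scal: "[:Poly_Mapping.single 0 c:] \<in> ?B" for c :: 'k
    by (rule const_in_rees_set[OF sub J mconst_in_mpolys])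
  have mono: "mono ?X" by (rule pconst.cleared_mono[OF plucker_index(1,2)])
  have T: "T i j \<in> ?X 1" if "i \<in> {1..n}" "j \<in> {1..n}" for i j
    by (rule pconst.plucker_cleared)
      (use that in \<open>auto simp: T_def maximal_minor_def minus_monom mult_monom diff_monom algebra_simps\<close>)
  have T12: "?b (1, 2) \<noteq> 0" using maximal_minor_12_neq_0 by (simp add: T_def)
  \<comment> \<open>Closed under the ring operations and containing the generators, hence all of the Rees algebra.\<close>
  define D where "D = {x \<in> ?B. \<exists>y\<in>?B. (\<exists>c. y \<in> ?X c) \<and> x - y \<in> P 0}"
  have "?B \<subseteq> D"
  proof (rule rees_set_subset[OF sub J minor_ideal_def edge_minors_subset])
    fix x x' assume "x \<in> D" "x' \<in> D"
    then obtain y c y' c' where x: "x \<in> ?B" "y \<in> ?B" "y \<in> ?X c" "x - y \<in> P 0"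
      and x': "x' \<in> ?B" "y' \<in> ?B" "y' \<in> ?X c'" "x' - y' \<in> P 0" by (auto simp: D_def)
    have "y \<in> ?X (max c c')" "y' \<in> ?X (max c c')"
      using x(3) x'(3) monoD[OF mono, of c "max c c'"] monoD[OF mono, of c' "max c c'"] by auto
    then have "y + y' \<in> ?X (max c c')"
      by (rule pconst.cleared_add)
    moreover have "(x - y) + (x' - y') \<in> P 0" using x x' by (intro P0(3))
    moreover have "(x - y) + (x' - y') = x + x' - (y + y')" by simp
    ultimately show "x + x' \<in> D"
      using subring_set_add[OF B] x(1,2) x'(1,2) unfolding D_def by auto
    have "y * y' \<in> ?X (c + c')" using x x' by (intro pconst.cleared_mult)
    moreover have "x * (x' - y') + y' * (x - y) \<in> P 0" using x x' by (intro P0(3,4))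
    moreover have "x * (x' - y') + y' * (x - y) = x * x' - y * y'" by (simp add: algebra_simps)
    ultimately show "x * x' \<in> D"
      using subring_set_mult[OF B] x(1,2) x'(1,2) unfolding D_def by auto
  next
    fix c :: "(xyvar, 'k) mpoly" assume c: "c \<in> ?C"
    let ?y = "[:Poly_Mapping.single 0 (Poly_Mapping.lookup c 0):] :: (xyvar, 'k) mpoly poly"
    have "?y \<in> ?X 0" by (rule pconst.scalar_in_cleared_0)
    moreover have "[:c:] - ?y \<in> P 0"
      using max[OF minus_const_in_hom_max_ideal[OF c]] by simp
    ultimately show "[:c:] \<in> D"
      using const_in_rees_set[OF sub J c] scal unfolding D_def by blast
  next
    fix g :: "(xyvar, 'k) mpoly" assume g: "g \<in> edge_minors n"
    then obtain i j where ij: "{i, j} \<in> complete_graph_edges n" "g = maximal_minor i j"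
      by (auto simp: edge_minors_def)
    have "Polynomial.monom g 1 = T i j" by (simp add: ij T_def)
    moreover have "T i j \<in> ?X 1" using complete_graph_edgesD[OF ij(1)] by (intro T) auto
    moreover have "Polynomial.monom g 1 \<in> ?B" by (rule monom_edge_minor_in_rees_set[OF g])
    ultimately show "Polynomial.monom g 1 \<in> D" using P0(2) unfolding D_def by auto
  qed
  then have exhaust: "\<exists>y\<in>?B. (\<exists>c. y \<in> ?X c) \<and> x - y \<in> P 0" if "x \<in> ?B" for x
    using that by (auto simp: D_def)
  have growth: "card A \<le> (2 * c + 1) ^ card (plucker_index n)"
    if "finite A" "pconst.independent A" "A \<subseteq> ?X c" for A c
    using plucker_index(1) T12 that by (rule pconst.card_independent_cleared)
  have "m \<le> card (plucker_index n)"
    using B scal chain pconst.one_in_cleared_0 mono pconst.cleared_mult growth exhaust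
    by (rule pconst.prime_chain_length_le_growth)
  then show ?thesis using plucker_index(3)[OF n] by simp
qed

theorem theorem4p1:
  fixes n :: nat
  assumes "infinite (UNIV :: 'k::field set)"
    and "n \<ge> 2"
  shows "analytic_spread (xyvars n)
           (binomial_edge_ideal n (complete_graph_edges n) :: (xyvar, 'k) mpoly set)
         = enat (2 * n - 3)"
proof -
  let ?S = "special_fiber (concrete_ring (mpolys (xyvars n))) (hom_max_ideal (xyvars n))
    (minor_ideal n :: (xyvar, 'k) mpoly set)"
  let ?B = "concrete_ring (rees_set (mpolys (xyvars n)) (minor_ideal n :: (xyvar, 'k) mpoly set))"
  note iff = special_fiber_prime_chain_iff[OF subring_set_mpolys ideal_minor_ideal
      hom_max_ideal_subset, of n]
  have "krull_dim ?S = enat (2 * n - 3)"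
  proof (rule krull_dim_eq_enatI)
    let ?P = "\<lambda>i. fiber_prime n (set (take i (kill_order n))) :: (xyvar, 'k) mpoly poly set"
    have "prime_chain ?B (2 * n - 3) ?P"
      unfolding prime_chain_def
      using primeideal_fiber_prime fiber_prime_strict[OF assms(2)] by blast
    then show "\<exists>Q. prime_chain ?S (2 * n - 3) Q"
      using hom_max_ideal_in_fiber_prime unfolding iff by blast
  next
    fix m Q assume "prime_chain ?S m Q"
    then have "\<exists>Q. prime_chain ?S m Q" by blast
    then obtain P where "prime_chain ?B m P" "\<forall>i\<le>m. \<forall>s\<in>hom_max_ideal (xyvars n). [:s:] \<in> P i"
      unfolding iff by blast
    then show "m \<le> 2 * n - 3" by (intro prime_chain_upper[OF assms(2)]) auto
  qed
  then show ?thesis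
    by (simp add: analytic_spread_def binomial_edge_ideal_complete_graph mpoly_ring_eq)
qed

end
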